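(* In the variety of all $T$-quasigroups, the word problem for free algebras is solvable; that is, for an alphabet $A$ there is an algorithm which, given any two words $P_1,P_2$ in the alphabet $A$ and the operation symbols $\cdot,/,\backslash$, decides whether $P_1$ and $P_2$ represent the same element of the free $T$-quasigroup with basis $A$.
   Context: A quasigroup is an algebra $(Q,\cdot,/,\backslash)$ with three binary operations satisfying the identities $(xy)/y=x$, $(x/y)y=x$, $y(y\backslash x)=x$, $y\backslash(yx)=x$. A quasigroup is called a $T$-quasigroup if there are an abelian group $(Q,+)$, automorphisms $\varphi,\psi\in \mathrm{Aut}(Q,+)$ and a fixed element $c\in Q$ such that $xy=\varphi x+c+\psi y$ for all $x,y\in Q$. The class of all $T$-quasigroups is a variety in the signature $\{\cdot,/,\backslash\}$. The free $T$-quasigroup with basis $A$ is the free algebra of this variety with basis $A$; two words represent the same element of it if and only if their equality holds as an identity in every $T$-quasigroup. *)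

theory Defs
  imports "HOL-Algebra.Group" "HOL-Library.Nat_Bijection"
begin

section \<open>Quasigroups and T-quasigroups\<close>

record 'q qalg = "'q partial_object" +
  qmult :: "'q \<Rightarrow> 'q \<Rightarrow> 'q"
  rdiv :: "'q \<Rightarrow> 'q \<Rightarrow> 'q"
  ldiv :: "'q \<Rightarrow> 'q \<Rightarrow> 'q"

text \<open>\<open>qmult Q x y\<close> is $x \cdot y$, \<open>rdiv Q x y\<close> is $x / y$, and \<open>ldiv Q y x\<close> is
  $y \backslash x$.\<close>

definition qalg_closed :: "'q qalg \<Rightarrow> bool" where
  "qalg_closed Q \<longleftrightarrow>
     (\<forall>x\<in>carrier Q. \<forall>y\<in>carrier Q.
        qmult Q x y \<in> carrier Q \<and> rdiv Q x y \<in> carrier Q \<and> ldiv Q x y \<in> carrier Q)"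

definition quasigroup :: "'q qalg \<Rightarrow> bool" where
  "quasigroup Q \<longleftrightarrow> qalg_closed Q \<and>
     (\<forall>x\<in>carrier Q. \<forall>y\<in>carrier Q.
        rdiv Q (qmult Q x y) y = x \<and>
        qmult Q (rdiv Q x y) y = x \<and>
        qmult Q y (ldiv Q y x) = x \<and>
        ldiv Q y (qmult Q y x) = x)"

text \<open>The abelian group is written multiplicatively, as \<^locale>\<open>comm_group\<close> prescribes.\<close>

definition T_quasigroup :: "'q qalg \<Rightarrow> bool" where
  "T_quasigroup Q \<longleftrightarrow> quasigroup Q \<and>
     (\<exists>(G :: 'q monoid) \<phi> \<psi> c.
        comm_group G \<and> carrier G = carrier Q \<and>
        \<phi> \<in> iso G G \<and> \<psi> \<in> iso G G \<and> c \<in> carrier Q \<and>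
        (\<forall>x\<in>carrier Q. \<forall>y\<in>carrier Q. qmult Q x y = \<phi> x \<otimes>\<^bsub>G\<^esub> c \<otimes>\<^bsub>G\<^esub> \<psi> y))"


section \<open>Words and the free T-quasigroup\<close>

datatype 'a qword =
    Letter 'a
  | Mult "'a qword" "'a qword"
  | RDiv "'a qword" "'a qword"
  | LDiv "'a qword" "'a qword"

definition words :: "'a set \<Rightarrow> 'a qword set" where
  "words A = {P. set_qword P \<subseteq> A}"

primrec eval :: "'q qalg \<Rightarrow> ('a \<Rightarrow> 'q) \<Rightarrow> 'a qword \<Rightarrow> 'q" where
  "eval Q h (Letter a) = h a"
| "eval Q h (Mult s t) = qmult Q (eval Q h s) (eval Q h t)"
| "eval Q h (RDiv s t) = rdiv Q (eval Q h s) (eval Q h t)"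
| "eval Q h (LDiv s t) = ldiv Q (eval Q h s) (eval Q h t)"

definition word_algebra :: "'a set \<Rightarrow> 'a qword qalg" where
  "word_algebra A = \<lparr>carrier = words A, qmult = Mult, rdiv = RDiv, ldiv = LDiv\<rparr>"

definition congruence :: "'q qalg \<Rightarrow> ('q \<times> 'q) set \<Rightarrow> bool" where
  "congruence Q \<theta> \<longleftrightarrow> equiv (carrier Q) \<theta> \<and>
     (\<forall>x x' y y'. (x, x') \<in> \<theta> \<longrightarrow> (y, y') \<in> \<theta> \<longrightarrow>
        (qmult Q x y, qmult Q x' y') \<in> \<theta> \<and>
        (rdiv Q x y, rdiv Q x' y') \<in> \<theta> \<and>
        (ldiv Q x y, ldiv Q x' y') \<in> \<theta>)"

definition lift_op :: "('q \<times> 'q) set \<Rightarrow> ('q \<Rightarrow> 'q \<Rightarrow> 'q) \<Rightarrow> 'q set \<Rightarrow> 'q set \<Rightarrow> 'q set" where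
  "lift_op \<theta> f X Y = (\<Union>x\<in>X. \<Union>y\<in>Y. \<theta> `` {f x y})"

definition quotient_alg :: "'q qalg \<Rightarrow> ('q \<times> 'q) set \<Rightarrow> 'q set qalg" where
  "quotient_alg Q \<theta> =
     \<lparr>carrier = carrier Q // \<theta>,
      qmult = lift_op \<theta> (qmult Q), rdiv = lift_op \<theta> (rdiv Q), ldiv = lift_op \<theta> (ldiv Q)\<rparr>"

text \<open>The free algebra with basis \<open>A\<close> is the word algebra modulo the intersection of all
  congruences whose quotient lies in the variety. This is the usual construction of
  free algebras, and it avoids quantifying over T-quasigroups of all types; that it has the
  expected properties is proved below (\<open>T_quasigroup_free\<close>, \<open>free_universal\<close>,
  \<open>free_eq_iff_identity\<close>).\<close>

definition free_cong :: "'a set \<Rightarrow> ('a qword \<times> 'a qword) set" where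
  "free_cong A = {(s, t) \<in> words A \<times> words A.
     \<forall>\<theta>. congruence (word_algebra A) \<theta> \<and> T_quasigroup (quotient_alg (word_algebra A) \<theta>)
        \<longrightarrow> (s, t) \<in> \<theta>}"

definition free_T_quasigroup :: "'a set \<Rightarrow> 'a qword set qalg" where
  "free_T_quasigroup A = quotient_alg (word_algebra A) (free_cong A)"

definition free_basis :: "'a set \<Rightarrow> 'a \<Rightarrow> 'a qword set" where
  "free_basis A a = free_cong A `` {Letter a}"

definition represented :: "'a set \<Rightarrow> 'a qword \<Rightarrow> 'a qword set" where
  "represented A P = eval (free_T_quasigroup A) (free_basis A) P"


section \<open>Algorithms\<close>

text \<open>\<open>recursive n f\<close>: on argument lists of length \<open>n\<close>, \<open>f\<close> is a total
  (general) recursive function. The last rule makes the values on lists of any other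
  length irrelevant.\<close>

inductive recursive :: "nat \<Rightarrow> (nat list \<Rightarrow> nat) \<Rightarrow> bool" where
  zero: "recursive n (\<lambda>xs. 0)"
| succ: "recursive 1 (\<lambda>xs. Suc (hd xs))"
| proj: "i < n \<Longrightarrow> recursive n (\<lambda>xs. xs ! i)"
| comp: "recursive (length gs) f \<Longrightarrow> (\<forall>g\<in>set gs. recursive n g) \<Longrightarrow>
    recursive n (\<lambda>xs. f (map (\<lambda>g. g xs) gs))"
| prim_rec: "recursive n g \<Longrightarrow> recursive (n + 2) h \<Longrightarrow>
    recursive (n + 1) (\<lambda>xs. rec_nat (g (tl xs)) (\<lambda>k r. h (k # r # tl xs)) (hd xs))"
| minimize: "recursive (n + 1) f \<Longrightarrow> (\<forall>xs. length xs = n \<longrightarrow> (\<exists>y. f (y # xs) = 0)) \<Longrightarrow>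
    recursive n (\<lambda>xs. LEAST y. f (y # xs) = 0)"
| ext: "recursive n f \<Longrightarrow> (\<forall>xs. length xs = n \<longrightarrow> f xs = g xs) \<Longrightarrow> recursive n g"

text \<open>Goedel numbers of words, relative to a numbering \<open>num\<close> of the letters.\<close>

primrec word_code :: "('a \<Rightarrow> nat) \<Rightarrow> 'a qword \<Rightarrow> nat" where
  "word_code num (Letter a) = prod_encode (0, num a)"
| "word_code num (Mult s t) = prod_encode (1, prod_encode (word_code num s, word_code num t))"
| "word_code num (RDiv s t) = prod_encode (2, prod_encode (word_code num s, word_code num t))"
| "word_code num (LDiv s t) = prod_encode (3, prod_encode (word_code num s, word_code num t))"

lemma inj_on_word_code:
  assumes "inj_on num A"
  shows "inj_on (word_code num) (words A)"
proof -
  have "P = P'" if "P \<in> words A" "P' \<in> words A" "word_code num P = word_code num P'" for P P'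
    using that
  proof (induction P arbitrary: P')
    case (Letter a)
    then show ?case using assms by (cases P') (auto simp: words_def inj_on_def)
  next
    case (Mult s t)
    then show ?case by (cases P') (auto simp: words_def)
  next
    case (RDiv s t)
    then show ?case by (cases P') (auto simp: words_def)
  next
    case (LDiv s t)
    then show ?case by (cases P') (auto simp: words_def)
  qed
  then show ?thesis by (auto simp: inj_on_def)
qed


section \<open>T-quasigroups form a variety\<close>

text \<open>For every \<open>e\<close>, a T-quasigroup is affine over the abelian group
  $x + y = (x / e) \cdot (e \backslash y)$ with zero $e \cdot e$, and the automorphisms are
  polynomials in the quasigroup operations. This turns the definition into identities.\<close>

definition pl where "pl Q e x y = qmult Q (rdiv Q x e) (ldiv Q e y)"
definition ze where "ze Q e = qmult Q e e"
definition ng where "ng Q e x = qmult Q e (ldiv Q (rdiv Q x e) (ze Q e))"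
definition ph where "ph Q e x = pl Q e (qmult Q x e) (ng Q e (qmult Q (ze Q e) e))"
definition ps where "ps Q e x = pl Q e (qmult Q e x) (ng Q e (qmult Q e (ze Q e)))"

definition T_identities :: "'q qalg \<Rightarrow> bool" where
  "T_identities Q \<longleftrightarrow>
     (\<forall>e\<in>carrier Q. \<forall>x\<in>carrier Q. \<forall>y\<in>carrier Q. \<forall>z\<in>carrier Q.
        pl Q e (pl Q e x y) z = pl Q e x (pl Q e y z) \<and>
        pl Q e x y = pl Q e y x \<and>
        ph Q e (pl Q e x y) = pl Q e (ph Q e x) (ph Q e y) \<and>
        ps Q e (pl Q e x y) = pl Q e (ps Q e x) (ps Q e y) \<and>
        qmult Q x y = pl Q e (pl Q e (ph Q e x) (qmult Q (ze Q e) (ze Q e))) (ps Q e y))"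

lemma quasigroupD:
  assumes "quasigroup Q" "x \<in> carrier Q" "y \<in> carrier Q"
  shows "qmult Q x y \<in> carrier Q" "rdiv Q x y \<in> carrier Q" "ldiv Q x y \<in> carrier Q"
    "rdiv Q (qmult Q x y) y = x" "qmult Q (rdiv Q x y) y = x"
    "qmult Q y (ldiv Q y x) = x" "ldiv Q y (qmult Q y x) = x"
  using assms unfolding quasigroup_def qalg_closed_def by blast+

lemma T_closed:
  assumes "quasigroup Q" "e \<in> carrier Q" "x \<in> carrier Q"
  shows "ze Q e \<in> carrier Q" "ng Q e x \<in> carrier Q" "ph Q e x \<in> carrier Q" "ps Q e x \<in> carrier Q"
    "y \<in> carrier Q \<Longrightarrow> pl Q e x y \<in> carrier Q"
  using assms by (auto simp: ze_def ng_def ph_def ps_def pl_def quasigroupD(1,2,3))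

lemma pl_zero:
  assumes "quasigroup Q" "e \<in> carrier Q" "x \<in> carrier Q"
  shows "pl Q e (ze Q e) x = x" "pl Q e x (ng Q e x) = ze Q e"
  using assms by (auto simp: ze_def ng_def pl_def quasigroupD)

lemma T_quasigroup_imp_identities:
  assumes "T_quasigroup Q"
  shows "T_identities Q"
proof -
  from assms have Q: "quasigroup Q" by (simp add: T_quasigroup_def)
  from assms obtain G :: "'a monoid" and \<phi> \<psi> c where "comm_group G"
    and car': "carrier G = carrier Q"
    and phi: "\<phi> \<in> iso G G" and psi: "\<psi> \<in> iso G G" and c': "c \<in> carrier Q"
    and mul': "\<forall>x\<in>carrier Q. \<forall>y\<in>carrier Q. qmult Q x y = \<phi> x \<otimes>\<^bsub>G\<^esub> c \<otimes>\<^bsub>G\<^esub> \<psi> y"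
    unfolding T_quasigroup_def by (elim conjE exE)
  note car = car'[symmetric] and c = c'[folded car']
    and mul = mul'[folded car', rule_format]
  interpret G: comm_group G by fact
  have phc: "\<phi> x \<in> carrier G" and psc: "\<psi> x \<in> carrier G" if "x \<in> carrier G" for x
    using phi psi that by (auto simp: iso_def hom_def)
  have phh: "\<phi> (x \<otimes>\<^bsub>G\<^esub> y) = \<phi> x \<otimes>\<^bsub>G\<^esub> \<phi> y" and psh: "\<psi> (x \<otimes>\<^bsub>G\<^esub> y) = \<psi> x \<otimes>\<^bsub>G\<^esub> \<psi> y"
    if "x \<in> carrier G" "y \<in> carrier G" for x y
    using phi psi that by (auto simp: iso_def hom_def)
  note Qc = quasigroupD[OF Q, unfolded car] T_closed[OF Q, unfolded car]
  note cl = phc psc c Qc(1-3) T_closed[OF Q, unfolded car]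
  have pl: "pl Q e x y \<otimes>\<^bsub>G\<^esub> ze Q e = x \<otimes>\<^bsub>G\<^esub> y"
    if "e \<in> carrier G" "x \<in> carrier G" "y \<in> carrier G" for e x y
  proof -
    let ?a = "rdiv Q x e" and ?b = "ldiv Q e y"
    have "\<phi> ?a \<otimes>\<^bsub>G\<^esub> c \<otimes>\<^bsub>G\<^esub> \<psi> e = x" "\<phi> e \<otimes>\<^bsub>G\<^esub> c \<otimes>\<^bsub>G\<^esub> \<psi> ?b = y"
      using that Qc(5)[of x e] Qc(6)[of y e] by (simp_all add: mul cl)
    moreover have "pl Q e x y \<otimes>\<^bsub>G\<^esub> ze Q e =
        (\<phi> ?a \<otimes>\<^bsub>G\<^esub> c \<otimes>\<^bsub>G\<^esub> \<psi> e) \<otimes>\<^bsub>G\<^esub> (\<phi> e \<otimes>\<^bsub>G\<^esub> c \<otimes>\<^bsub>G\<^esub> \<psi> ?b)"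
      using that by (simp add: pl_def ze_def mul cl G.m_ac)
    ultimately show ?thesis by simp
  qed
  have ng: "x \<otimes>\<^bsub>G\<^esub> ng Q e x = ze Q e \<otimes>\<^bsub>G\<^esub> ze Q e"
    if "e \<in> carrier G" "x \<in> carrier G" for e x
    using pl[of e x "ng Q e x"] pl_zero(2)[OF Q, unfolded car, of e x] that by (simp add: cl)
  have diff: "pl Q e x (ng Q e y) \<otimes>\<^bsub>G\<^esub> y = x \<otimes>\<^bsub>G\<^esub> ze Q e"
    if "e \<in> carrier G" "x \<in> carrier G" "y \<in> carrier G" for e x y
  proof -
    have "(pl Q e x (ng Q e y) \<otimes>\<^bsub>G\<^esub> y) \<otimes>\<^bsub>G\<^esub> ze Q e = (pl Q e x (ng Q e y) \<otimes>\<^bsub>G\<^esub> ze Q e) \<otimes>\<^bsub>G\<^esub> y"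
      using that by (simp add: cl G.m_ac)
    also have "\<dots> = x \<otimes>\<^bsub>G\<^esub> (y \<otimes>\<^bsub>G\<^esub> ng Q e y)"
      using that pl[of e x "ng Q e y"] by (simp add: cl G.m_ac)
    also have "\<dots> = (x \<otimes>\<^bsub>G\<^esub> ze Q e) \<otimes>\<^bsub>G\<^esub> ze Q e"
      using that ng[of e y] by (simp add: cl G.m_assoc)
    finally show ?thesis
      using that by (subst (asm) G.right_cancel) (auto intro: cl)
  qed
  have ph: "ph Q e x \<otimes>\<^bsub>G\<^esub> \<phi> (ze Q e) = \<phi> x \<otimes>\<^bsub>G\<^esub> ze Q e"
    if "e \<in> carrier G" "x \<in> carrier G" for e x
  proof -
    have "(ph Q e x \<otimes>\<^bsub>G\<^esub> \<phi> (ze Q e)) \<otimes>\<^bsub>G\<^esub> (c \<otimes>\<^bsub>G\<^esub> \<psi> e) = ph Q e x \<otimes>\<^bsub>G\<^esub> qmult Q (ze Q e) e"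
      using that by (simp add: mul cl G.m_assoc)
    also have "\<dots> = qmult Q x e \<otimes>\<^bsub>G\<^esub> ze Q e"
      unfolding ph_def using that by (intro diff) (auto intro: cl)
    also have "\<dots> = (\<phi> x \<otimes>\<^bsub>G\<^esub> ze Q e) \<otimes>\<^bsub>G\<^esub> (c \<otimes>\<^bsub>G\<^esub> \<psi> e)"
      using that by (simp add: mul cl G.m_ac)
    finally show ?thesis
      using that by (subst (asm) G.right_cancel) (auto intro: cl)
  qed
  have ps: "ps Q e x \<otimes>\<^bsub>G\<^esub> \<psi> (ze Q e) = \<psi> x \<otimes>\<^bsub>G\<^esub> ze Q e"
    if "e \<in> carrier G" "x \<in> carrier G" for e x
  proof -
    have "(ps Q e x \<otimes>\<^bsub>G\<^esub> \<psi> (ze Q e)) \<otimes>\<^bsub>G\<^esub> (\<phi> e \<otimes>\<^bsub>G\<^esub> c) = ps Q e x \<otimes>\<^bsub>G\<^esub> qmult Q e (ze Q e)"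
      using that by (simp add: mul cl G.m_ac)
    also have "\<dots> = qmult Q e x \<otimes>\<^bsub>G\<^esub> ze Q e"
      unfolding ps_def using that by (intro diff) (auto intro: cl)
    also have "\<dots> = (\<psi> x \<otimes>\<^bsub>G\<^esub> ze Q e) \<otimes>\<^bsub>G\<^esub> (\<phi> e \<otimes>\<^bsub>G\<^esub> c)"
      using that by (simp add: mul cl G.m_ac)
    finally show ?thesis
      using that by (subst (asm) G.right_cancel) (auto intro: cl)
  qed
  have pl': "pl Q e x y = x \<otimes>\<^bsub>G\<^esub> y \<otimes>\<^bsub>G\<^esub> inv\<^bsub>G\<^esub> (ze Q e)"
    if "e \<in> carrier G" "x \<in> carrier G" "y \<in> carrier G" for e x y
    using pl[OF that] that by (subst G.inv_solve_right) (simp_all add: cl)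
  show ?thesis
    unfolding T_identities_def car
  proof (intro ballI conjI)
    fix e x y z assume e: "e \<in> carrier G" "x \<in> carrier G" "y \<in> carrier G" "z \<in> carrier G"
    let ?o = "ze Q e"
    have o: "?o \<in> carrier G" using e by (simp add: cl)
    show "pl Q e (pl Q e x y) z = pl Q e x (pl Q e y z)"
      using e o by (simp add: pl' G.m_ac)
    show "pl Q e x y = pl Q e y x"
      using e o by (simp add: pl' G.m_ac)
    have hom: "f (pl Q e x y) = pl Q e (f x) (f y)"
      if f: "\<And>u. u \<in> carrier G \<Longrightarrow> f u \<in> carrier G"
        and g: "\<And>u. u \<in> carrier G \<Longrightarrow> g u \<in> carrier G"
        and fg: "\<And>u. u \<in> carrier G \<Longrightarrow> f u \<otimes>\<^bsub>G\<^esub> g ?o = g u \<otimes>\<^bsub>G\<^esub> ?o"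
        and gh: "\<And>u v. u \<in> carrier G \<Longrightarrow> v \<in> carrier G \<Longrightarrow> g (u \<otimes>\<^bsub>G\<^esub> v) = g u \<otimes>\<^bsub>G\<^esub> g v"
      for f g
    proof -
      let ?p = "pl Q e x y"
      have p: "?p \<in> carrier G" "pl Q e (f x) (f y) \<in> carrier G" using e f by (simp_all add: cl)
      have "f ?p \<otimes>\<^bsub>G\<^esub> (g ?o \<otimes>\<^bsub>G\<^esub> g ?o) = (f ?p \<otimes>\<^bsub>G\<^esub> g ?o) \<otimes>\<^bsub>G\<^esub> g ?o"
        using p o f g by (simp add: G.m_assoc)
      also have "\<dots> = g (?p \<otimes>\<^bsub>G\<^esub> ?o) \<otimes>\<^bsub>G\<^esub> ?o"
        unfolding fg[OF p(1)] gh[OF p(1) o] using p o f g by (simp add: G.m_ac)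
      also have "\<dots> = g x \<otimes>\<^bsub>G\<^esub> g y \<otimes>\<^bsub>G\<^esub> ?o"
        using e by (simp add: pl gh)
      finally have 1: "f ?p \<otimes>\<^bsub>G\<^esub> (g ?o \<otimes>\<^bsub>G\<^esub> g ?o) \<otimes>\<^bsub>G\<^esub> ?o = g x \<otimes>\<^bsub>G\<^esub> g y \<otimes>\<^bsub>G\<^esub> ?o \<otimes>\<^bsub>G\<^esub> ?o"
        by simp
      have "pl Q e (f x) (f y) \<otimes>\<^bsub>G\<^esub> (g ?o \<otimes>\<^bsub>G\<^esub> g ?o) \<otimes>\<^bsub>G\<^esub> ?o
          = (pl Q e (f x) (f y) \<otimes>\<^bsub>G\<^esub> ?o) \<otimes>\<^bsub>G\<^esub> (g ?o \<otimes>\<^bsub>G\<^esub> g ?o)"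
        using p o g by (simp add: G.m_ac)
      also have "\<dots> = (f x \<otimes>\<^bsub>G\<^esub> g ?o) \<otimes>\<^bsub>G\<^esub> (f y \<otimes>\<^bsub>G\<^esub> g ?o)"
        using e o f g by (simp add: pl G.m_ac)
      also have "\<dots> = g x \<otimes>\<^bsub>G\<^esub> g y \<otimes>\<^bsub>G\<^esub> ?o \<otimes>\<^bsub>G\<^esub> ?o"
        using e o g by (simp add: fg G.m_ac)
      finally show ?thesis
        using 1 p o g f e
          G.right_cancel[of "g ?o \<otimes>\<^bsub>G\<^esub> g ?o \<otimes>\<^bsub>G\<^esub> ?o" "f ?p" "pl Q e (f x) (f y)"]
        by (simp add: G.m_assoc)
    qed
    show "ph Q e (pl Q e x y) = pl Q e (ph Q e x) (ph Q e y)"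
      by (rule hom[where g = \<phi>]) (use e in \<open>simp_all add: cl ph phh\<close>)
    show "ps Q e (pl Q e x y) = pl Q e (ps Q e x) (ps Q e y)"
      by (rule hom[where g = \<psi>]) (use e in \<open>simp_all add: cl ps psh\<close>)
    let ?r = "pl Q e (pl Q e (ph Q e x) (qmult Q ?o ?o)) (ps Q e y)"
    have r: "?r \<in> carrier G" "pl Q e (ph Q e x) (qmult Q ?o ?o) \<in> carrier G"
      using e o by (simp_all add: cl)
    let ?w = "?o \<otimes>\<^bsub>G\<^esub> ?o \<otimes>\<^bsub>G\<^esub> (\<phi> ?o \<otimes>\<^bsub>G\<^esub> \<psi> ?o)"
    have w: "?w \<in> carrier G" using o by (simp add: cl)
    have "?r \<otimes>\<^bsub>G\<^esub> ?w = (?r \<otimes>\<^bsub>G\<^esub> ?o) \<otimes>\<^bsub>G\<^esub> (?o \<otimes>\<^bsub>G\<^esub> (\<phi> ?o \<otimes>\<^bsub>G\<^esub> \<psi> ?o))"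
      using r o by (simp add: cl G.m_ac)
    also have "?r \<otimes>\<^bsub>G\<^esub> ?o = pl Q e (ph Q e x) (qmult Q ?o ?o) \<otimes>\<^bsub>G\<^esub> ps Q e y"
      using e r by (intro pl) (simp_all add: cl)
    also have "\<dots> \<otimes>\<^bsub>G\<^esub> (?o \<otimes>\<^bsub>G\<^esub> (\<phi> ?o \<otimes>\<^bsub>G\<^esub> \<psi> ?o))
        = (pl Q e (ph Q e x) (qmult Q ?o ?o) \<otimes>\<^bsub>G\<^esub> ?o) \<otimes>\<^bsub>G\<^esub> (ps Q e y \<otimes>\<^bsub>G\<^esub> \<psi> ?o) \<otimes>\<^bsub>G\<^esub> \<phi> ?o"
      using e r o by (simp add: cl G.m_ac)
    also have "\<dots> = (ph Q e x \<otimes>\<^bsub>G\<^esub> qmult Q ?o ?o) \<otimes>\<^bsub>G\<^esub> (\<psi> y \<otimes>\<^bsub>G\<^esub> ?o) \<otimes>\<^bsub>G\<^esub> \<phi> ?o"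
      using e o by (simp add: pl ps cl)
    also have "\<dots> = (ph Q e x \<otimes>\<^bsub>G\<^esub> \<phi> ?o) \<otimes>\<^bsub>G\<^esub> qmult Q ?o ?o \<otimes>\<^bsub>G\<^esub> (\<psi> y \<otimes>\<^bsub>G\<^esub> ?o)"
      using e o by (simp add: cl G.m_ac)
    also have "\<dots> = (\<phi> x \<otimes>\<^bsub>G\<^esub> ?o) \<otimes>\<^bsub>G\<^esub> (\<phi> ?o \<otimes>\<^bsub>G\<^esub> c \<otimes>\<^bsub>G\<^esub> \<psi> ?o) \<otimes>\<^bsub>G\<^esub> (\<psi> y \<otimes>\<^bsub>G\<^esub> ?o)"
      using e o by (simp add: ph mul)
    also have "\<dots> = qmult Q x y \<otimes>\<^bsub>G\<^esub> ?w"
      using e o by (simp add: mul cl G.m_ac)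
    finally show "qmult Q x y = ?r"
      using r w e G.right_cancel[of ?w ?r "qmult Q x y"] by (simp add: cl)
  qed
qed

lemma identities_imp_T_quasigroup:
  assumes Q: "quasigroup Q" and ne: "carrier Q \<noteq> {}" and T: "T_identities Q"
  shows "T_quasigroup Q"
proof -
  from ne obtain e where e: "e \<in> carrier Q" by blast
  define G where "G = \<lparr>carrier = carrier Q, mult = pl Q e, one = ze Q e\<rparr>"
  have G [simp]: "carrier G = carrier Q" "\<And>x y. x \<otimes>\<^bsub>G\<^esub> y = pl Q e x y" "\<one>\<^bsub>G\<^esub> = ze Q e"
    by (simp_all add: G_def)
  note cl = quasigroupD(1-3)[OF Q] T_closed[OF Q]
  note id = T[unfolded T_identities_def, rule_format, OF e]
  have "comm_group G"
  proof (rule comm_groupI)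
    show "\<exists>y\<in>carrier G. y \<otimes>\<^bsub>G\<^esub> x = \<one>\<^bsub>G\<^esub>" if "x \<in> carrier G" for x
      using that e id[of x "ng Q e x" x] pl_zero(2)[OF Q e, of x] cl(5)[of e x]
      by (intro bexI[of _ "ng Q e x"]) auto
    show "x \<otimes>\<^bsub>G\<^esub> y = y \<otimes>\<^bsub>G\<^esub> x" if "x \<in> carrier G" "y \<in> carrier G" for x y
      using that id[of x y x] by simp
    show "x \<otimes>\<^bsub>G\<^esub> y \<otimes>\<^bsub>G\<^esub> z = x \<otimes>\<^bsub>G\<^esub> (y \<otimes>\<^bsub>G\<^esub> z)"
      if "x \<in> carrier G" "y \<in> carrier G" "z \<in> carrier G" for x y z
      using that id[of x y z] unfolding G by blast
  qed (use e in \<open>auto simp: cl pl_zero[OF Q]\<close>)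
  then interpret G: comm_group G .
  have shift: "bij_betw (\<lambda>x. pl Q e x u) (carrier Q) (carrier Q)" if u: "u \<in> carrier Q" for u
  proof (rule bij_betwI[where g = "\<lambda>x. x \<otimes>\<^bsub>G\<^esub> inv\<^bsub>G\<^esub> u"])
    show "(\<lambda>x. pl Q e x u) \<in> carrier Q \<rightarrow> carrier Q" using u e cl by auto
    show "(\<lambda>x. x \<otimes>\<^bsub>G\<^esub> inv\<^bsub>G\<^esub> u) \<in> carrier Q \<rightarrow> carrier Q"
      using u G.m_closed G.inv_closed unfolding G(1) by blast
    fix x assume x: "x \<in> carrier Q"
    show "pl Q e x u \<otimes>\<^bsub>G\<^esub> inv\<^bsub>G\<^esub> u = x"
      using x u G.m_assoc[of x u "inv\<^bsub>G\<^esub> u"] G.r_inv[of u] G.r_one[of x] G.inv_closed[of u] by simp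
    show "pl Q e (x \<otimes>\<^bsub>G\<^esub> inv\<^bsub>G\<^esub> u) u = x"
      using x u G.m_assoc[of x "inv\<^bsub>G\<^esub> u" u] G.l_inv[of u] G.r_one[of x] G.inv_closed[of u] by simp
  qed
  have "bij_betw (\<lambda>x. qmult Q x e) (carrier Q) (carrier Q)"
    by (rule bij_betwI[where g = "\<lambda>x. rdiv Q x e"]) (use e in \<open>auto simp: quasigroupD[OF Q]\<close>)
  moreover have "bij_betw (\<lambda>x. qmult Q e x) (carrier Q) (carrier Q)"
    by (rule bij_betwI[where g = "\<lambda>x. ldiv Q e x"]) (use e in \<open>auto simp: quasigroupD[OF Q]\<close>)
  ultimately have bij: "bij_betw (ph Q e) (carrier Q) (carrier Q)" "bij_betw (ps Q e) (carrier Q) (carrier Q)"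
    using bij_betw_trans[OF _ shift[of "ng Q e (qmult Q (ze Q e) e)"]]
      bij_betw_trans[OF _ shift[of "ng Q e (qmult Q e (ze Q e))"]] e
    by (auto simp: ph_def[abs_def] ps_def[abs_def] comp_def cl)
  have "ph Q e \<in> iso G G" "ps Q e \<in> iso G G"
    using bij e id by (auto simp: iso_def hom_def cl)
  moreover have "qmult Q (ze Q e) (ze Q e) \<in> carrier Q" using e by (simp add: cl)
  moreover have "qmult Q x y = ph Q e x \<otimes>\<^bsub>G\<^esub> qmult Q (ze Q e) (ze Q e) \<otimes>\<^bsub>G\<^esub> ps Q e y"
    if "x \<in> carrier Q" "y \<in> carrier Q" for x y
    using id[OF that e] by simp
  ultimately show ?thesis
    unfolding T_quasigroup_def using Q \<open>comm_group G\<close> G(1) by blast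
qed

lemma T_quasigroup_nonempty:
  assumes "T_quasigroup Q"
  shows "carrier Q \<noteq> {}"
  using assms unfolding T_quasigroup_def by blast

theorem T_quasigroup_iff:
  "T_quasigroup Q \<longleftrightarrow> quasigroup Q \<and> carrier Q \<noteq> {} \<and> T_identities Q"
  using T_quasigroup_imp_identities[of Q] identities_imp_T_quasigroup[of Q]
    T_quasigroup_nonempty[of Q] T_quasigroup_def[of Q]
  by blast


section \<open>Properties of the free T-quasigroup\<close>

lemma carrier_word_algebra [simp]:
  "carrier (word_algebra A) = words A" "qmult (word_algebra A) = Mult"
  "rdiv (word_algebra A) = RDiv" "ldiv (word_algebra A) = LDiv"
  by (simp_all add: word_algebra_def)

lemma words_simps [simp]:
  "Letter a \<in> words A \<longleftrightarrow> a \<in> A"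
  "Mult s t \<in> words A \<longleftrightarrow> s \<in> words A \<and> t \<in> words A"
  "RDiv s t \<in> words A \<longleftrightarrow> s \<in> words A \<and> t \<in> words A"
  "LDiv s t \<in> words A \<longleftrightarrow> s \<in> words A \<and> t \<in> words A"
  by (auto simp: words_def)

lemma words_empty [simp]: "words {} = {}"
proof -
  have "P \<notin> words {}" for P :: "'a qword" by (induction P) auto
  then show ?thesis by blast
qed

lemma eval_closed:
  assumes "qalg_closed Q" "h \<in> A \<rightarrow> carrier Q" "P \<in> words A"
  shows "eval Q h P \<in> carrier Q"
  using assms(3,1,2) by (induction P) (auto simp: qalg_closed_def)

lemma lift_op_class:
  assumes "equiv X \<theta>" "x \<in> X" "y \<in> X"
    and "\<And>x x' y y'. (x, x') \<in> \<theta> \<Longrightarrow> (y, y') \<in> \<theta> \<Longrightarrow> (f x y, f x' y') \<in> \<theta>"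
  shows "lift_op \<theta> f (\<theta> `` {x}) (\<theta> `` {y}) = \<theta> `` {f x y}"
proof -
  have "\<theta> `` {f x' y'} = \<theta> `` {f x y}" if "(x, x') \<in> \<theta>" "(y, y') \<in> \<theta>" for x' y'
    using equiv_class_eq[OF assms(1) assms(4)[OF that]] by simp
  moreover have "(x, x) \<in> \<theta>" "(y, y) \<in> \<theta>"
    using assms by (auto simp: equiv_def refl_on_def)
  ultimately show ?thesis unfolding lift_op_def by blast
qed

lemma quotient_class:
  assumes "congruence Q \<theta>" "x \<in> carrier Q" "y \<in> carrier Q"
  shows "qmult (quotient_alg Q \<theta>) (\<theta> `` {x}) (\<theta> `` {y}) = \<theta> `` {qmult Q x y}"
    "rdiv (quotient_alg Q \<theta>) (\<theta> `` {x}) (\<theta> `` {y}) = \<theta> `` {rdiv Q x y}"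
    "ldiv (quotient_alg Q \<theta>) (\<theta> `` {x}) (\<theta> `` {y}) = \<theta> `` {ldiv Q x y}"
  unfolding quotient_alg_def qalg.simps
  by (rule lift_op_class; use assms in \<open>auto simp: congruence_def\<close>)+

lemma eval_quotient:
  assumes "congruence (word_algebra A) \<theta>" "P \<in> words A"
  shows "eval (quotient_alg (word_algebra A) \<theta>) (\<lambda>a. \<theta> `` {Letter a}) P = \<theta> `` {P}"
  using assms(2) by (induction P) (auto simp: quotient_class[OF assms(1)])

lemma quotient_T_quasigroup:
  fixes Q :: "'i \<Rightarrow> 'q qalg"
  assumes T: "\<And>i. i \<in> I \<Longrightarrow> T_quasigroup (Q i)" and h: "\<And>i. i \<in> I \<Longrightarrow> h i \<in> A \<rightarrow> carrier (Q i)"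
    and \<theta>: "\<theta> = {(s, t) \<in> words A \<times> words A. \<forall>i\<in>I. eval (Q i) (h i) s = eval (Q i) (h i) t}"
  shows "congruence (word_algebra A) \<theta>"
    and "A \<noteq> {} \<Longrightarrow> T_quasigroup (quotient_alg (word_algebra A) \<theta>)"
proof -
  show cong: "congruence (word_algebra A) \<theta>"
    unfolding congruence_def equiv_def \<theta> by (auto simp: refl_on_def sym_def trans_def)
  then have eq: "equiv (words A) \<theta>" by (simp add: congruence_def)
  assume "A \<noteq> {}"
  let ?F = "quotient_alg (word_algebra A) \<theta>"
  have car: "carrier ?F = (\<lambda>s. \<theta> `` {s}) ` words A"
    by (auto simp: quotient_alg_def quotient_def)
  have cls: "\<theta> `` {s} = \<theta> `` {t} \<longleftrightarrow> (\<forall>i\<in>I. eval (Q i) (h i) s = eval (Q i) (h i) t)"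
    if "s \<in> words A" "t \<in> words A" for s t
    using eq_equiv_class_iff[OF eq that] that by (auto simp: \<theta>)
  have ev: "eval (Q i) (h i) s \<in> carrier (Q i)" if "i \<in> I" "s \<in> words A" for i s
    using eval_closed[OF _ h] T that by (simp add: T_quasigroup_def quasigroup_def)
  have qg: "quasigroup (Q i)" and ti: "T_identities (Q i)" if "i \<in> I" for i
    using T[OF that] by (simp_all add: T_quasigroup_iff)
  note ops = quotient_class[OF cong, simplified]
  have "quasigroup ?F"
    unfolding quasigroup_def qalg_closed_def car
    by (auto simp: ops cls quasigroupD[OF qg] ev)
  moreover have "carrier ?F \<noteq> {}"
  proof -
    from \<open>A \<noteq> {}\<close> obtain a where "a \<in> A" by blast
    then have "\<theta> `` {Letter a} \<in> carrier ?F" unfolding car by simp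
    then show ?thesis by blast
  qed
  moreover have "T_identities ?F"
  proof -
    let ?W = "word_algebra A"
    have wpl: "pl ?W e s t \<in> words A"
      "pl ?F (\<theta> `` {e}) (\<theta> `` {s}) (\<theta> `` {t}) = \<theta> `` {pl ?W e s t}"
      if "e \<in> words A" "s \<in> words A" "t \<in> words A" for e s t
      using that by (auto simp: pl_def ops)
    have wze: "ze ?W e \<in> words A" "ze ?F (\<theta> `` {e}) = \<theta> `` {ze ?W e}"
      if "e \<in> words A" for e
      using that by (auto simp: ze_def ops)
    have wng: "ng ?W e s \<in> words A" "ng ?F (\<theta> `` {e}) (\<theta> `` {s}) = \<theta> `` {ng ?W e s}"
      if "e \<in> words A" "s \<in> words A" for e s
      using that by (auto simp: ng_def ops wze)
    have wph: "ph ?W e s \<in> words A" "ph ?F (\<theta> `` {e}) (\<theta> `` {s}) = \<theta> `` {ph ?W e s}"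
      and wps: "ps ?W e s \<in> words A" "ps ?F (\<theta> `` {e}) (\<theta> `` {s}) = \<theta> `` {ps ?W e s}"
      if "e \<in> words A" "s \<in> words A" for e s
      using that by (auto simp: ph_def ps_def ops wze wng wpl)
    have e: "eval R g (pl ?W u s t) = pl R (eval R g u) (eval R g s) (eval R g t)"
      "eval R g (ze ?W u) = ze R (eval R g u)"
      "eval R g (ng ?W u s) = ng R (eval R g u) (eval R g s)"
      "eval R g (ph ?W u s) = ph R (eval R g u) (eval R g s)"
      "eval R g (ps ?W u s) = ps R (eval R g u) (eval R g s)" for R :: "'q qalg" and g u s t
      by (simp_all add: pl_def ze_def ng_def ph_def ps_def)
    show ?thesis
      unfolding T_identities_def car ball_simps
    proof (intro ballI, goal_cases)
      case (1 u s t v)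
      then show ?case
        by (simp add: ops wpl wze wng wph wps cls e)
           (use ti[unfolded T_identities_def, rule_format, OF _ ev ev ev ev] in blast)
    qed
  qed
  ultimately show "T_quasigroup ?F" by (simp add: T_quasigroup_iff)
qed

lemma free_cong_family:
  defines "I A \<equiv> {\<theta>. congruence (word_algebra A) \<theta> \<and> T_quasigroup (quotient_alg (word_algebra A) \<theta>)}"
  shows "free_cong A = {(s, t) \<in> words A \<times> words A.
    \<forall>\<theta>\<in>I A. eval (quotient_alg (word_algebra A) \<theta>) (\<lambda>a. \<theta> `` {Letter a}) s =
            eval (quotient_alg (word_algebra A) \<theta>) (\<lambda>a. \<theta> `` {Letter a}) t}"
proof -
  have "(s, t) \<in> \<theta> \<longleftrightarrow> eval (quotient_alg (word_algebra A) \<theta>) (\<lambda>a. \<theta> `` {Letter a}) s =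
            eval (quotient_alg (word_algebra A) \<theta>) (\<lambda>a. \<theta> `` {Letter a}) t"
    if "\<theta> \<in> I A" "s \<in> words A" "t \<in> words A" for \<theta> s t
  proof -
    have c: "congruence (word_algebra A) \<theta>" using that by (simp add: I_def)
    then have "equiv (words A) \<theta>" by (simp add: congruence_def)
    then show ?thesis
      using that by (simp add: eval_quotient[OF c] eq_equiv_class_iff)
  qed
  then show ?thesis unfolding free_cong_def I_def by blast
qed

lemma
  shows congruence_free_cong: "congruence (word_algebra A) (free_cong A)"
    and T_quasigroup_free: "A \<noteq> {} \<Longrightarrow> T_quasigroup (free_T_quasigroup A)"
proof -
  have h: "(\<lambda>a. \<theta> `` {Letter a}) \<in> A \<rightarrow> carrier (quotient_alg (word_algebra A) \<theta>)" for \<theta>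
    by (auto simp: quotient_alg_def intro: quotientI)
  show "congruence (word_algebra A) (free_cong A)"
    by (rule quotient_T_quasigroup(1)[OF _ h free_cong_family]) simp
  show "A \<noteq> {} \<Longrightarrow> T_quasigroup (free_T_quasigroup A)"
    unfolding free_T_quasigroup_def
    by (rule quotient_T_quasigroup(2)[OF _ h free_cong_family]) simp_all
qed

lemma represented_eq_class:
  "P \<in> words A \<Longrightarrow> represented A P = free_cong A `` {P}"
  unfolding represented_def free_T_quasigroup_def free_basis_def
  by (rule eval_quotient[OF congruence_free_cong])

lemma represented_eq_iff:
  assumes "P1 \<in> words A" "P2 \<in> words A"
  shows "represented A P1 = represented A P2 \<longleftrightarrow> (P1, P2) \<in> free_cong A"
proof -
  have "equiv (words A) (free_cong A)"
    using congruence_free_cong[of A] by (simp add: congruence_def)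
  from eq_equiv_class_iff[OF this assms] show ?thesis
    using assms by (simp add: represented_eq_class)
qed

lemma carrier_free: "carrier (free_T_quasigroup A) = represented A ` words A"
  by (auto simp: free_T_quasigroup_def quotient_alg_def quotient_def represented_eq_class)

theorem free_identity:
  fixes Q :: "'q qalg"
  assumes T: "T_quasigroup Q" and h: "h \<in> A \<rightarrow> carrier Q"
    and P: "P1 \<in> words A" "P2 \<in> words A" "represented A P1 = represented A P2"
  shows "eval Q h P1 = eval Q h P2"
proof (cases "A = {}")
  case True
  then show ?thesis using P by simp
next
  case False
  define \<theta> where "\<theta> = {(s, t) \<in> words A \<times> words A. \<forall>i\<in>{()}. eval Q h s = eval Q h t}"
  have "congruence (word_algebra A) \<theta>" "T_quasigroup (quotient_alg (word_algebra A) \<theta>)"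
    using quotient_T_quasigroup[of "{()}" "\<lambda>_. Q" "\<lambda>_. h" A \<theta>] T h False \<theta>_def by simp_all
  moreover have "(P1, P2) \<in> free_cong A" using P represented_eq_iff by blast
  ultimately have "(P1, P2) \<in> \<theta>" by (auto simp: free_cong_def)
  then show ?thesis by (simp add: \<theta>_def)
qed

theorem free_eq_iff_identity:
  fixes A :: "'a set"
  assumes "P1 \<in> words A" "P2 \<in> words A"
  shows "represented A P1 = represented A P2 \<longleftrightarrow>
    (\<forall>(Q :: 'a qword set qalg) h. T_quasigroup Q \<and> h \<in> A \<rightarrow> carrier Q \<longrightarrow>
       eval Q h P1 = eval Q h P2)"
proof
  assume R: "\<forall>(Q :: 'a qword set qalg) h. T_quasigroup Q \<and> h \<in> A \<rightarrow> carrier Q \<longrightarrow>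
       eval Q h P1 = eval Q h P2"
  have "A \<noteq> {}" using assms by auto
  moreover have "free_basis A \<in> A \<rightarrow> carrier (free_T_quasigroup A)"
    by (auto simp: free_basis_def free_T_quasigroup_def quotient_alg_def intro!: quotientI)
  ultimately show "represented A P1 = represented A P2"
    using R[rule_format, OF conjI, OF T_quasigroup_free, of A "free_basis A"]
    unfolding represented_def by blast
qed (use free_identity assms in blast)

theorem free_universal:
  fixes Q :: "'q qalg"
  assumes T: "T_quasigroup Q" and h: "h \<in> A \<rightarrow> carrier Q"
  shows "\<exists>f. f \<in> carrier (free_T_quasigroup A) \<rightarrow> carrier Q \<and>
    (\<forall>a\<in>A. f (free_basis A a) = h a) \<and>
    (\<forall>x\<in>carrier (free_T_quasigroup A). \<forall>y\<in>carrier (free_T_quasigroup A).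
       f (qmult (free_T_quasigroup A) x y) = qmult Q (f x) (f y) \<and>
       f (rdiv (free_T_quasigroup A) x y) = rdiv Q (f x) (f y) \<and>
       f (ldiv (free_T_quasigroup A) x y) = ldiv Q (f x) (f y))"
proof -
  define f where "f X = eval Q h (SOME P. P \<in> words A \<and> represented A P = X)" for X
  have f: "f (represented A P) = eval Q h P" if "P \<in> words A" for P
  proof -
    have "\<exists>P'. P' \<in> words A \<and> represented A P' = represented A P" using that by blast
    from someI_ex[OF this] show ?thesis
      unfolding f_def using free_identity[OF T h _ that] by blast
  qed
  let ?F = "free_T_quasigroup A"
  have ops: "qmult ?F (represented A s) (represented A t) = represented A (Mult s t)"
    "rdiv ?F (represented A s) (represented A t) = represented A (RDiv s t)"
    "ldiv ?F (represented A s) (represented A t) = represented A (LDiv s t)" for s t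
    by (simp_all add: represented_def)
  have "qalg_closed Q" using T by (simp add: T_quasigroup_def quasigroup_def)
  then have "f \<in> carrier ?F \<rightarrow> carrier Q"
    unfolding carrier_free by (auto simp: f eval_closed[OF _ h])
  moreover have "f (free_basis A a) = h a" if "a \<in> A" for a
    using f[of "Letter a"] that by (simp add: represented_def)
  moreover have "\<forall>x\<in>carrier ?F. \<forall>y\<in>carrier ?F. f (qmult ?F x y) = qmult Q (f x) (f y) \<and>
       f (rdiv ?F x y) = rdiv Q (f x) (f y) \<and> f (ldiv ?F x y) = ldiv Q (f x) (f y)"
    unfolding carrier_free by (auto simp: ops f)
  ultimately show ?thesis by blast
qed

end

theory Submission
  imports Defs "HOL-Library.Multiset"
begin

text \<open>Over a T-quasigroup every word unfolds to a signed sum of terms $u(z)$, where \<open>u\<close> is a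
  reduced group word in $\varphi, \psi$ and \<open>z\<close> is a letter or the constant \<open>c\<close>.
  If two words yield the same signed sum, they agree in every T-quasigroup. Conversely, numbering the
  terms and sending the term number \<open>k\<close> to $B^k$ is realised by a T-quasigroup of integer functions
  on group words, so equal words have equal values $\sum \pm B^k$; once the base \<open>B\<close> exceeds the
  number of terms, this value determines the signed sum. Hence it suffices to
  compute one integer, which a stack machine working on codes does.\<close>

section \<open>Recursive functions\<close>

text \<open>Stated through applied projections, a closure fact is proved once for fixed argument
  positions and then transfers to arbitrary recursive arguments.\<close>

lemma recursive_comp1:
  assumes "recursive 1 (\<lambda>xs. F (xs ! 0))" "recursive n f"
  shows "recursive n (\<lambda>xs. F (f xs))"
  using recursive.comp[of "[f]" "\<lambda>xs. F (xs ! 0)" n] assms by simp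

lemma recursive_comp2:
  assumes "recursive 2 (\<lambda>xs. F (xs ! 0) (xs ! 1))" "recursive n f" "recursive n g"
  shows "recursive n (\<lambda>xs. F (f xs) (g xs))"
  using recursive.comp[of "[f, g]" "\<lambda>xs. F (xs ! 0) (xs ! 1)" n] assms
  by (simp add: numeral_2_eq_2)

lemma recursive_comp3:
  assumes "recursive 3 (\<lambda>xs. F (xs ! 0) (xs ! 1) (xs ! 2))"
    "recursive n f" "recursive n g" "recursive n h"
  shows "recursive n (\<lambda>xs. F (f xs) (g xs) (h xs))"
  using recursive.comp[of "[f, g, h]" "\<lambda>xs. F (xs ! 0) (xs ! 1) (xs ! 2)" n] assms
  by (simp add: numeral_2_eq_2 numeral_3_eq_3)

lemma recursive_proj_drop:
  assumes "2 + i < n" shows "recursive n (\<lambda>xs. drop 2 xs ! i)"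
  by (rule recursive.ext[OF recursive.proj[OF assms]]) (use assms in simp)

lemma recursive_Suc:
  assumes "recursive n f" shows "recursive n (\<lambda>xs. Suc (f xs))"
proof (rule recursive_comp1[OF _ assms])
  show "recursive 1 (\<lambda>xs. Suc (xs ! 0))"
    by (rule recursive.ext[OF recursive.succ]) (auto simp: length_Suc_conv)
qed

lemma recursive_const: "recursive n (\<lambda>xs. c)"
  by (induction c) (auto intro: recursive.zero recursive_Suc)

text \<open>\<open>prim_rec\<close> recurses on the head of its argument list; composing it with
  \<open>b\<close> followed by all \<open>n\<close> projections allows any recursive bound and keeps
  the parameters.\<close>

lemma recursive_rec_nat:
  assumes g: "recursive n g" and h: "recursive (n + 2) (\<lambda>ys. h (ys ! 0) (ys ! 1) (drop 2 ys))"
    and b: "recursive n b"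
  shows "recursive n (\<lambda>xs. rec_nat (g xs) (\<lambda>k r. h k r xs) (b xs))"
proof -
  let ?F = "\<lambda>xs. rec_nat (g (tl xs)) (\<lambda>k r. h k r (tl xs)) (hd xs)"
  have "recursive (n + 1) ?F"
    using recursive.prim_rec[OF g h] by (simp add: numeral_2_eq_2)
  then have F: "recursive (length (b # map (\<lambda>i xs. xs ! i) [0..<n])) ?F"
    by simp
  have "recursive n (\<lambda>xs. ?F (map (\<lambda>g. g xs) (b # map (\<lambda>i xs. xs ! i) [0..<n])))"
    by (rule recursive.comp[OF F]) (auto intro: b recursive.proj)
  then show ?thesis
    by (rule recursive.ext) (auto simp: comp_def, metis map_nth)
qed

lemma recursive_add:
  assumes "recursive n f" "recursive n g"
  shows "recursive n (\<lambda>xs. f xs + g xs)"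
proof (rule recursive_comp2[OF _ assms])
  have "recursive 2 (\<lambda>xs. rec_nat (xs ! 0) (\<lambda>k r. Suc r) (xs ! 1))"
    by (intro recursive_rec_nat recursive_Suc recursive.proj) simp_all
  moreover have "rec_nat m (\<lambda>k r. Suc r) l = m + l" for m l by (induction l) auto
  ultimately show "recursive 2 (\<lambda>xs. xs ! 0 + xs ! 1)" by simp
qed

lemma recursive_mult:
  assumes "recursive n f" "recursive n g"
  shows "recursive n (\<lambda>xs. f xs * g xs)"
proof (rule recursive_comp2[OF _ assms])
  have "recursive 2 (\<lambda>xs. rec_nat 0 (\<lambda>k r. r + xs ! 0) (xs ! 1))"
    by (intro recursive_rec_nat recursive_add recursive_const recursive.proj recursive_proj_drop)
      simp_all
  moreover have "rec_nat 0 (\<lambda>k r. r + m) l = m * l" for m l :: nat by (induction l) auto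
  ultimately show "recursive 2 (\<lambda>xs. xs ! 0 * xs ! 1)" by simp
qed

lemma recursive_power:
  assumes "recursive n f" "recursive n g"
  shows "recursive n (\<lambda>xs. f xs ^ g xs)"
proof (rule recursive_comp2[OF _ assms])
  have "recursive 2 (\<lambda>xs. rec_nat 1 (\<lambda>k r. r * xs ! 0) (xs ! 1))"
    by (intro recursive_rec_nat recursive_mult recursive_const recursive.proj recursive_proj_drop)
      simp_all
  moreover have "rec_nat 1 (\<lambda>k r. r * m) l = m ^ l" for m l :: nat by (induction l) auto
  ultimately show "recursive 2 (\<lambda>xs. xs ! 0 ^ xs ! 1)" by simp
qed

lemma recursive_pred:
  assumes "recursive n f" shows "recursive n (\<lambda>xs. f xs - 1)"
proof (rule recursive_comp1[OF _ assms])
  have "recursive 1 (\<lambda>xs. rec_nat 0 (\<lambda>k r. k) (xs ! 0))"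
    by (intro recursive_rec_nat recursive_const recursive.proj) simp_all
  moreover have "rec_nat 0 (\<lambda>k r. k) l = l - 1" for l by (induction l) auto
  ultimately show "recursive 1 (\<lambda>xs. xs ! 0 - 1)" by simp
qed

lemma recursive_diff:
  assumes "recursive n f" "recursive n g"
  shows "recursive n (\<lambda>xs. f xs - g xs)"
proof (rule recursive_comp2[OF _ assms])
  have "recursive 2 (\<lambda>xs. rec_nat (xs ! 0) (\<lambda>k r. r - 1) (xs ! 1))"
    by (intro recursive_rec_nat recursive_pred recursive.proj) simp_all
  moreover have "rec_nat m (\<lambda>k r. r - 1) l = m - l" for m l by (induction l) auto
  ultimately show "recursive 2 (\<lambda>xs. xs ! 0 - xs ! 1)" by simp
qed

lemma recursive_if_eq:
  assumes "recursive n f" "recursive n g" "recursive n u" "recursive n v"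
  shows "recursive n (\<lambda>xs. if f xs = g xs then u xs else v xs)"
proof -
  \<comment> \<open>With truncated subtraction, \<open>(f xs - g xs) + (g xs - f xs)\<close>
    vanishes exactly on equality, so subtracting it from 1 gives the indicator of equality.\<close>
  have "recursive n (\<lambda>xs. (1 - ((f xs - g xs) + (g xs - f xs))) * u xs +
      (1 - (1 - ((f xs - g xs) + (g xs - f xs)))) * v xs)"
    by (intro recursive_add recursive_mult recursive_diff recursive_const assms)
  then show ?thesis by (rule recursive.ext) auto
qed

section \<open>Inverting the Cantor pairing function\<close>

lemma recursive_triangle:
  assumes "recursive n f" shows "recursive n (\<lambda>xs. triangle (f xs))"
proof (rule recursive_comp1[OF _ assms])
  have "recursive 1 (\<lambda>xs. rec_nat 0 (\<lambda>k r. r + Suc k) (xs ! 0))"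
    by (intro recursive_rec_nat recursive_add recursive_Suc recursive_const recursive.proj) simp_all
  moreover have "rec_nat 0 (\<lambda>k r. r + Suc k) l = triangle l" for l by (induction l) auto
  ultimately show "recursive 1 (\<lambda>xs. triangle (xs ! 0))" by simp
qed

lemma recursive_prod_encode:
  assumes "recursive n f" "recursive n g"
  shows "recursive n (\<lambda>xs. prod_encode (f xs, g xs))"
  unfolding prod_encode_def prod.case
  by (intro recursive_add recursive_triangle assms)

lemma triangle_mono: "m \<le> n \<Longrightarrow> triangle m \<le> triangle n"
  by (induction n rule: nat_induct) (auto simp: le_Suc_eq)

text \<open>The sum of the two coordinates of \<open>p\<close>: the least \<open>s\<close> with
  \<open>p < triangle (Suc s)\<close>, phrased as a zero because \<open>minimize\<close> searches
  for zeros.\<close>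

definition prod_diagonal :: "nat \<Rightarrow> nat" where
  "prod_diagonal p = (LEAST s. Suc p - triangle (Suc s) = 0)"

lemma prod_diagonal_encode: "prod_diagonal (prod_encode (a, b)) = a + b"
  unfolding prod_diagonal_def
proof (rule Least_equality)
  show "Suc (prod_encode (a, b)) - triangle (Suc (a + b)) = 0"
    by (simp add: prod_encode_def)
next
  fix s assume *: "Suc (prod_encode (a, b)) - triangle (Suc s) = 0"
  show "a + b \<le> s"
  proof (rule ccontr)
    assume "\<not> a + b \<le> s"
    then have "triangle (Suc s) \<le> triangle (a + b)" by (intro triangle_mono) simp
    with * show False by (simp add: prod_encode_def)
  qed
qed

lemma recursive_prod_diagonal:
  assumes "recursive n f" shows "recursive n (\<lambda>xs. prod_diagonal (f xs))"
proof (rule recursive_comp1[OF _ assms])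
  have "recursive (1 + 1) (\<lambda>ys. Suc (ys ! 1) - triangle (Suc (ys ! 0)))"
    by (intro recursive_diff recursive_triangle recursive_Suc recursive.proj) simp_all
  moreover have "\<exists>y. Suc m - triangle (Suc y) = 0" for m
    by (rule exI[of _ m]) (induction m; simp)
  ultimately have "recursive 1 (\<lambda>xs. LEAST y. Suc ((y # xs) ! 1) - triangle (Suc ((y # xs) ! 0)) = 0)"
    by (intro recursive.minimize) auto
  then show "recursive 1 (\<lambda>xs. prod_diagonal (xs ! 0))"
    by (simp add: prod_diagonal_def)
qed

lemma
  assumes "recursive n f"
  shows recursive_fst: "recursive n (\<lambda>xs. fst (prod_decode (f xs)))"
    and recursive_snd: "recursive n (\<lambda>xs. snd (prod_decode (f xs)))"
proof -
  \<comment> \<open>As \<open>prod_encode (a, b) = triangle (a + b) + a\<close>, knowing the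
    diagonal \<open>a + b\<close> makes both coordinates truncated differences.\<close>
  have "fst (prod_decode p) = p - triangle (prod_diagonal p) \<and>
    snd (prod_decode p) = prod_diagonal p - (p - triangle (prod_diagonal p))" for p
  proof -
    obtain a b where "prod_decode p = (a, b)" by fastforce
    then have "p = prod_encode (a, b)" by (metis prod_decode_inverse)
    then show ?thesis by (simp add: prod_diagonal_encode) (simp add: prod_encode_def)
  qed
  then show "recursive n (\<lambda>xs. fst (prod_decode (f xs)))"
    "recursive n (\<lambda>xs. snd (prod_decode (f xs)))"
    by (simp_all only:)
      (intro recursive_diff recursive_triangle recursive_prod_diagonal assms)+
qed

lemmas recursive_intros = recursive_const recursive_Suc recursive_add recursive_mult
  recursive_power recursive_pred recursive_diff recursive_if_eq recursive_prod_encode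
  recursive_fst recursive_snd


section \<open>Words in the two automorphisms\<close>

text \<open>The numbers $0, 1, 2, 3$ stand for $\varphi, \varphi^{-1}, \psi, \psi^{-1}$.
  A list stands for the composition in which its head is applied first.\<close>

definition opp :: "nat \<Rightarrow> nat" where
  "opp k = (if even k then Suc k else k - 1)"

lemma opp_simps [simp]: "opp 0 = 1" "opp (Suc 0) = 0" "opp 2 = 3" "opp 3 = 2" "opp (opp k) = k"
  by (auto simp: opp_def)

definition cons_red :: "nat \<Rightarrow> nat list \<Rightarrow> nat list" where
  "cons_red k w = (if w \<noteq> [] \<and> hd w = opp k then tl w else k # w)"

fun reduced :: "nat list \<Rightarrow> bool" where
  "reduced (x # y # w) \<longleftrightarrow> y \<noteq> opp x \<and> reduced (y # w)"
| "reduced _ \<longleftrightarrow> True"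

lemma reduced_tl: "reduced w \<Longrightarrow> reduced (tl w)"
  by (induction w rule: reduced.induct) auto

lemma reduced_Cons: "reduced (x # w) \<longleftrightarrow> (w \<noteq> [] \<longrightarrow> hd w \<noteq> opp x) \<and> reduced w"
  by (cases w) auto

lemma reduced_cons_red: "reduced w \<Longrightarrow> reduced (cons_red k w)"
  by (auto simp: cons_red_def reduced_tl reduced_Cons)

text \<open>If \<open>w\<close> begins with \<open>k\<close>, the inner call deletes it, and
  reducedness keeps the outer call from cancelling against the next entry.\<close>

lemma cons_red_opp:
  assumes "reduced w" shows "cons_red k (cons_red (opp k) w) = w"
  using assms by (cases w) (auto simp: cons_red_def reduced_Cons)

text \<open>Fixing the words that are not reduced turns \<open>cons_red k\<close> into a permutation of all lists.\<close>

definition shift :: "nat \<Rightarrow> nat list \<Rightarrow> nat list" where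
  "shift k w = (if reduced w then cons_red k w else w)"

lemma shift_opp: "shift k (shift (opp k) w) = w"
  by (simp add: shift_def reduced_cons_red cons_red_opp)

lemma shift_inverses [simp]:
  "shift 0 (shift (Suc 0) w) = w" "shift (Suc 0) (shift 0 w) = w"
  "shift 2 (shift 3 w) = w" "shift 3 (shift 2 w) = w"
  using shift_opp[of 0 w] shift_opp[of 1 w] shift_opp[of 2 w] shift_opp[of 3 w] by simp_all


section \<open>Normal forms\<close>

definition key :: "nat \<Rightarrow> nat list \<Rightarrow> nat" where
  "key x w = prod_encode (x, list_encode w)"

definition single_if :: "bool \<Rightarrow> nat \<Rightarrow> nat multiset" where
  "single_if b k = (if b then {#k#} else {#})"

text \<open>In a T-quasigroup, $x / y = \varphi^{-1}(x - c - \psi y)$ and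
  $x \backslash y = \psi^{-1}(y - c - \varphi x)$, so the value of a word \<open>P\<close>, moved by the
  automorphism \<open>w\<close>, is a sum of terms $\pm u(z)$ with \<open>u\<close> a reduced word
  and \<open>z\<close> either \<open>c\<close> (number \<open>0\<close>) or a letter \<open>a\<close> (number \<open>Suc (num a)\<close>).
  \<open>terms num P w True\<close> collects the keys of the positive terms and
  \<open>terms num P w False\<close> those of the negative terms.\<close>

primrec terms :: "('a \<Rightarrow> nat) \<Rightarrow> 'a qword \<Rightarrow> nat list \<Rightarrow> bool \<Rightarrow> nat multiset" where
  "terms num (Letter a) w b = single_if b (key (Suc (num a)) w)"
| "terms num (Mult s t) w b = single_if b (key 0 w) +
     terms num s (cons_red 0 w) b + terms num t (cons_red 2 w) b"
| "terms num (RDiv s t) w b = single_if (\<not> b) (key 0 (cons_red 1 w)) +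
     terms num s (cons_red 1 w) b + terms num t (cons_red 2 (cons_red 1 w)) (\<not> b)"
| "terms num (LDiv s t) w b = single_if (\<not> b) (key 0 (cons_red 3 w)) +
     terms num t (cons_red 3 w) b + terms num s (cons_red 0 (cons_red 3 w)) (\<not> b)"

section \<open>Base \<open>B\<close> expansions of multisets\<close>

definition power_sum :: "nat \<Rightarrow> nat multiset \<Rightarrow> nat" where
  "power_sum B M = (\<Sum>k\<in>#M. B ^ k)"

lemma power_sum_simps [simp]:
  "power_sum B {#} = 0" "power_sum B {#k#} = B ^ k" "power_sum B (M + N) = power_sum B M + power_sum B N"
  "power_sum B (single_if b k) = (if b then B ^ k else 0)"
  by (simp_all add: power_sum_def single_if_def)

lemma digits_less:
  fixes B :: nat
  assumes "\<And>k. c k < B"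
  shows "(\<Sum>k<n. c k * B ^ k) < B ^ n"
proof (induction n)
  case (Suc n)
  have "c n * B ^ n + B ^ n \<le> B * B ^ n"
    using mult_le_mono1[of "Suc (c n)" B "B ^ n"] assms[of n] by simp
  with Suc show ?case by simp
qed simp

text \<open>The lower digits sum to less than \<open>B ^ n\<close> by \<open>digits_less\<close>, so
  division by \<open>B ^ n\<close> isolates the top digit.\<close>

lemma digits_unique:
  fixes B :: nat
  assumes "\<And>k. c k < B" "\<And>k. d k < B"
    and "(\<Sum>k<n. c k * B ^ k) = (\<Sum>k<n. d k * B ^ k)"
  shows "k < n \<Longrightarrow> c k = d k"
  using assms(3)
proof (induction n)
  case (Suc n)
  let ?C = "\<Sum>k<n. c k * B ^ k" and ?D = "\<Sum>k<n. d k * B ^ k"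
  have lt: "?C < B ^ n" "?D < B ^ n" using digits_less assms by blast+
  then have "B ^ n \<noteq> 0" by linarith
  have eq: "?C + c n * B ^ n = ?D + d n * B ^ n" using Suc.prems by simp
  have "(?C + c n * B ^ n) div B ^ n = c n" "(?D + d n * B ^ n) div B ^ n = d n"
    using lt div_mult_self1[OF \<open>B ^ n \<noteq> 0\<close>] by simp_all
  with eq have "c n = d n" by metis
  with eq have "?C = ?D" by simp
  with Suc \<open>c n = d n\<close> show ?case by (auto simp: less_Suc_eq)
qed simp

lemma power_sum_count:
  assumes "\<And>k. k \<in># M \<Longrightarrow> k < n"
  shows "power_sum B M = (\<Sum>k<n. count M k * B ^ k)"
  using assms
proof (induction M)
  case (add x M)
  have "(\<Sum>k<n. count (add_mset x M) k * B ^ k) =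
      (\<Sum>k<n. count M k * B ^ k + (if k = x then B ^ k else 0))"
    by (rule sum.cong) auto
  also have "\<dots> = (\<Sum>k<n. count M k * B ^ k) + B ^ x"
    using add.prems by (simp add: sum.distrib)
  finally show ?case using add by (simp add: power_sum_def)
qed simp

text \<open>Each multiplicity is at most the size, hence a legitimate digit, and base
  \<open>B\<close> digits are unique.\<close>

lemma power_sum_inject:
  assumes "size M < B" "size N < B" "power_sum B M = power_sum B N"
  shows "M = N"
proof (rule multiset_eqI)
  fix x
  \<comment> \<open>Including \<open>x\<close> in the maximum puts it among the compared digits even
    if it lies in neither multiset.\<close>
  define n where "n = Suc (Max (insert x (set_mset (M + N))))"
  have lt: "k < n" if "k \<in> insert x (set_mset (M + N))" for k
    unfolding n_def less_Suc_eq_le by (rule Max_ge[OF _ that]) simp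
  have "power_sum B M = (\<Sum>k<n. count M k * B ^ k)" "power_sum B N = (\<Sum>k<n. count N k * B ^ k)"
    by (intro power_sum_count lt; simp)+
  moreover have "count M k < B" "count N k < B" for k
    using assms(1,2) count_le_size[of M k] count_le_size[of N k] by linarith+
  ultimately show "count M x = count N x"
    using assms(3) digits_unique[of "count M" B "count N" n x] lt[of x] by simp
qed


section \<open>Normal forms decide equality\<close>

text \<open>The group is pointwise addition, \<phi> and \<psi> are precomposition with
  \<open>shift 0\<close> and \<open>shift 2\<close>, the fixed element is \<open>c\<close>, and the
  divisions are the explicit solutions.\<close>

definition word_fun_alg :: "(nat list \<Rightarrow> int) \<Rightarrow> (nat list \<Rightarrow> int) qalg" where
  "word_fun_alg c = \<lparr>carrier = UNIV,
     qmult = (\<lambda>f g w. f (shift 0 w) + c w + g (shift 2 w)),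
     rdiv = (\<lambda>f g w. f (shift 1 w) - c (shift 1 w) - g (shift 2 (shift 1 w))),
     ldiv = (\<lambda>f g w. g (shift 3 w) - c (shift 3 w) - f (shift 0 (shift 3 w)))\<rparr>"

lemma T_quasigroup_word_fun_alg: "T_quasigroup (word_fun_alg c)"
proof -
  define G :: "(nat list \<Rightarrow> int) monoid"
    where "G = \<lparr>carrier = UNIV, monoid.mult = (\<lambda>f g w. f w + g w), one = (\<lambda>w. 0)\<rparr>"
  have "comm_group G"
  proof (rule comm_groupI)
    fix f assume "f \<in> carrier G"
    show "\<exists>g\<in>carrier G. g \<otimes>\<^bsub>G\<^esub> f = \<one>\<^bsub>G\<^esub>"
      by (rule bexI[of _ "\<lambda>w. - f w"]) (auto simp: G_def)
  qed (auto simp: G_def)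
  moreover have iso: "(\<lambda>f w. f (shift k w)) \<in> iso G G" for k
  proof -
    have "bij (\<lambda>(f :: nat list \<Rightarrow> int) w. f (shift k w))"
      by (rule o_bij[of "\<lambda>f w. f (shift (opp k) w)"])
        (use shift_opp[of k] shift_opp[of "opp k"] in \<open>auto simp: fun_eq_iff\<close>)
    then show ?thesis by (auto simp: iso_def hom_def G_def)
  qed
  moreover have "quasigroup (word_fun_alg c)"
    by (auto simp: quasigroup_def qalg_closed_def word_fun_alg_def fun_eq_iff)
  moreover have "carrier G = carrier (word_fun_alg c)"
    "\<forall>x\<in>carrier (word_fun_alg c). \<forall>y\<in>carrier (word_fun_alg c). qmult (word_fun_alg c) x y =
      (\<lambda>w. x (shift 0 w)) \<otimes>\<^bsub>G\<^esub> c \<otimes>\<^bsub>G\<^esub> (\<lambda>w. y (shift 2 w))"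
    by (auto simp: G_def word_fun_alg_def)
  moreover have "c \<in> carrier (word_fun_alg c)" by (simp add: word_fun_alg_def)
  ultimately show ?thesis
    unfolding T_quasigroup_def
    by (intro conjI exI[of _ G] exI[of _ "\<lambda>f w. f (shift 0 w)"]
        exI[of _ "\<lambda>f w. f (shift 2 w)"] exI[of _ c])
qed

text \<open>Reading a product at \<open>w\<close> reads its factors at \<open>cons_red 0 w\<close>
  and \<open>cons_red 2 w\<close>, which is the recursion of \<open>terms\<close>; reducedness makes
  \<open>shift\<close> agree with \<open>cons_red\<close>.\<close>

lemma eval_word_fun_alg:
  assumes "reduced w"
  shows "eval (word_fun_alg (\<lambda>w. int (B ^ key 0 w))) (\<lambda>a w. int (B ^ key (Suc (num a)) w)) P w =
    int (power_sum B (terms num P w True)) - int (power_sum B (terms num P w False))"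
  using assms
  by (induction P arbitrary: w)
    (simp_all add: word_fun_alg_def shift_def reduced_cons_red del: of_nat_power)

text \<open>Equal words have equal values in the function model, compared here at the empty list;
  moving the negative parts across turns this into an equation of naturals.\<close>

lemma power_sum_terms_eq:
  assumes "P1 \<in> words A" "P2 \<in> words A" "represented A P1 = represented A P2"
  shows "power_sum B (terms num P1 [] True + terms num P2 [] False) =
    power_sum B (terms num P2 [] True + terms num P1 [] False)"
proof -
  let ?Q = "word_fun_alg (\<lambda>w. int (B ^ key 0 w))" and ?h = "\<lambda>a w. int (B ^ key (Suc (num a)) w)"
  have "eval ?Q ?h P1 = eval ?Q ?h P2"
    by (rule free_identity[OF T_quasigroup_word_fun_alg _ assms]) (simp add: word_fun_alg_def)
  then have "eval ?Q ?h P1 [] = eval ?Q ?h P2 []" by simp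
  then show ?thesis by (simp only: eval_word_fun_alg reduced.simps power_sum_simps)
qed

text \<open>The test on \<open>y\<close> makes the folded function commute on the whole type.\<close>

definition mset_prod :: "('q, 'm) monoid_scheme \<Rightarrow> ('k \<Rightarrow> 'q) \<Rightarrow> 'k multiset \<Rightarrow> 'q" where
  "mset_prod G v M =
     fold_mset (\<lambda>k y. if y \<in> carrier G then v k \<otimes>\<^bsub>G\<^esub> y else y) \<one>\<^bsub>G\<^esub> M"

section \<open>Laws of multiset products in an abelian group\<close>

context comm_group
begin

context
  fixes v :: "'k \<Rightarrow> 'a"
  assumes v: "\<And>k. v k \<in> carrier G"
begin

lemma mset_prod_empty: "mset_prod G v {#} = \<one>"
  by (simp add: mset_prod_def)

text \<open>The fold unfolds to a product only if the folded value lies in the carrier, so both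
  claims go through one induction.\<close>

lemma mset_prod_add_mset:
  "mset_prod G v (add_mset k M) = v k \<otimes> mset_prod G v M \<and> mset_prod G v M \<in> carrier G"
proof (induction M arbitrary: k)
  interpret comp_fun_commute "\<lambda>k y. if y \<in> carrier G then v k \<otimes> y else y"
    by unfold_locales (auto simp: fun_eq_iff v m_lcomm)
  case empty
  show ?case by (simp add: mset_prod_def v)
  case (add x M)
  have "mset_prod G v (add_mset x M) \<in> carrier G" using add[of x] v by simp
  then show ?case by (simp add: mset_prod_def)
qed

lemma mset_prod_closed: "mset_prod G v M \<in> carrier G"
  using mset_prod_add_mset by blast

lemma mset_prod_single: "mset_prod G v {#k#} = v k"
  using mset_prod_add_mset[of k "{#}"] by (simp add: mset_prod_empty v)

lemma mset_prod_union: "mset_prod G v (M + N) = mset_prod G v M \<otimes> mset_prod G v N"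
  by (induction M) (simp_all add: mset_prod_empty mset_prod_add_mset mset_prod_closed v m_assoc)

end

end

text \<open>Keys can be interpreted in any \<open>Q\<close>, where a word evaluates to the sum of
  its positive terms minus the sum of its negative ones.\<close>

lemma eval_eq_of_terms_eq:
  fixes Q :: "'q qalg" and A :: "'a set"
  assumes T: "T_quasigroup Q" and h: "h \<in> A \<rightarrow> carrier Q" and num: "inj_on num A"
    and P: "P1 \<in> words A" "P2 \<in> words A"
    and eq: "terms num P1 [] True + terms num P2 [] False =
      terms num P2 [] True + terms num P1 [] False"
  shows "eval Q h P1 = eval Q h P2"
proof -
  from T have Q: "quasigroup Q" by (simp add: T_quasigroup_def)
  from T obtain G :: "'q monoid" and \<phi> \<psi> c where "comm_group G"
    and car: "carrier G = carrier Q"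
    and phi: "\<phi> \<in> iso G G" and psi: "\<psi> \<in> iso G G" and c': "c \<in> carrier Q"
    and mul': "\<forall>x\<in>carrier Q. \<forall>y\<in>carrier Q. qmult Q x y = \<phi> x \<otimes>\<^bsub>G\<^esub> c \<otimes>\<^bsub>G\<^esub> \<psi> y"
    unfolding T_quasigroup_def by (elim conjE exE)
  interpret G: comm_group G by fact
  note c = c'[folded car] and mul = mul'[folded car, rule_format]
    and qg = quasigroupD[OF Q, folded car]
  \<comment> \<open>Numbers from 4 on also get \<psi> or its inverse, so that
    \<open>gen (opp k)\<close> inverts \<open>gen k\<close> for every \<open>k\<close>.\<close>
  define gen where "gen k = (if k < 2 then if even k then \<phi> else inv_into (carrier G) \<phi>
    else if even k then \<psi> else inv_into (carrier G) \<psi>)" for k :: nat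
  have gen_iso: "gen k \<in> iso G G" for k
    using phi psi G.iso_set_sym by (auto simp: gen_def)
  have bij: "bij_betw \<phi> (carrier G) (carrier G)" "bij_betw \<psi> (carrier G) (carrier G)"
    using phi psi by (auto simp: iso_def)
  have gen_opp: "gen (opp k) (gen k x) = x" if "x \<in> carrier G" for k x
  proof -
    have "opp k < 2 \<longleftrightarrow> k < 2" "even (opp k) \<longleftrightarrow> odd k" by (auto simp: opp_def elim: oddE)
    then show ?thesis
      using that bij by (auto simp: gen_def bij_betw_inv_into_left bij_betw_inv_into_right)
  qed
  have gen_closed: "gen k x \<in> carrier G" if "x \<in> carrier G" for k x
    using gen_iso[of k] that by (auto simp: iso_def hom_def)
  have gen_mult: "gen k (x \<otimes>\<^bsub>G\<^esub> y) = gen k x \<otimes>\<^bsub>G\<^esub> gen k y"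
    if "x \<in> carrier G" "y \<in> carrier G" for k x y
    using gen_iso[of k] that by (auto simp: iso_def hom_def)
  define act where "act = fold gen"
  have act_closed: "act w x \<in> carrier G" if "x \<in> carrier G" for w x
    using that unfolding act_def by (induction w arbitrary: x) (auto simp: gen_closed)
  have act_mult: "act w (x \<otimes>\<^bsub>G\<^esub> y) = act w x \<otimes>\<^bsub>G\<^esub> act w y"
    if "x \<in> carrier G" "y \<in> carrier G" for w x y
    using that unfolding act_def by (induction w arbitrary: x y) (auto simp: gen_closed gen_mult)
  have act_red: "act (cons_red k w) x = act w (gen k x)" if "x \<in> carrier G" for k w x
    using that by (cases w) (auto simp: act_def cons_red_def gen_opp)
  have gens: "gen 0 = \<phi>" "gen 2 = \<psi>" by (simp_all add: gen_def)
  have gens': "gen (Suc 0) (\<phi> x) = x" "gen 3 (\<psi> x) = x" if "x \<in> carrier G" for x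
    using gen_opp[OF that, of 0] gen_opp[OF that, of 2] by (simp_all add: gens)
  have cl: "\<phi> x \<in> carrier G" "\<psi> x \<in> carrier G" if "x \<in> carrier G" for x
    using gen_closed[OF that, of 0] gen_closed[OF that, of 2] by (simp_all add: gens)
  \<comment> \<open>Inverts the numbering of constant and letters. Numbers of neither default to
    \<open>c\<close>, so that \<open>v\<close> maps every key into the carrier.\<close>
  define atom where "atom x = (if x \<noteq> 0 \<and> x - 1 \<in> num ` A then h (inv_into A num (x - 1)) else c)" for x
  have atom_closed: "atom x \<in> carrier G" for x
    using h c car inv_into_into[of "x - 1" num A] by (auto simp: atom_def)
  define v where "v p = act (list_decode (snd (prod_decode p))) (atom (fst (prod_decode p)))" for p
  have v_closed: "v p \<in> carrier G" for p by (simp add: v_def act_closed atom_closed)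
  have v_key: "v (key x w) = act w (atom x)" for x w by (simp add: v_def key_def)
  have v_c: "v (key 0 w) = act w c" for w by (simp add: v_key atom_def)
  have v_letter: "v (key (Suc (num a)) w) = act w (h a)" if "a \<in> A" for a w
    using that num by (simp add: v_key atom_def)
  define S where "S = mset_prod G v"
  have S_closed: "S M \<in> carrier G" for M
    unfolding S_def by (rule G.mset_prod_closed[OF v_closed])
  have S_simps: "S (M + N) = S M \<otimes>\<^bsub>G\<^esub> S N" "S (single_if b k) = (if b then v k else \<one>\<^bsub>G\<^esub>)" for M N b k
    by (simp_all add: S_def G.mset_prod_union v_closed single_if_def G.mset_prod_single G.mset_prod_empty)
  have ev_closed: "eval Q h P \<in> carrier G" if "P \<in> words A" for P
    using eval_closed[OF _ h that] Q car by (simp add: quasigroup_def)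
  \<comment> \<open>The induction step shared by both divisions: \<open>z\<close> is the quotient,
    \<open>d\<close> the constant, \<open>s\<close> the dividend and \<open>t\<close> the divisor;
    \<open>ps\<close>, \<open>pt\<close> are positive sums and \<open>ns\<close>, \<open>nt\<close>
    negative ones.\<close>
  have key_eq: "z \<otimes>\<^bsub>G\<^esub> (d \<otimes>\<^bsub>G\<^esub> ns \<otimes>\<^bsub>G\<^esub> pt) = ps \<otimes>\<^bsub>G\<^esub> nt"
    if "z \<otimes>\<^bsub>G\<^esub> d \<otimes>\<^bsub>G\<^esub> t = s" "s \<otimes>\<^bsub>G\<^esub> ns = ps" "t \<otimes>\<^bsub>G\<^esub> nt = pt"
      "z \<in> carrier G" "d \<in> carrier G" "t \<in> carrier G" "ns \<in> carrier G" "nt \<in> carrier G"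
    for z d s t ns ps nt pt
    using that(4-8) unfolding that(1-3)[symmetric] by (simp add: G.m_ac)
  \<comment> \<open>Keeping the negative terms on the left avoids inverses; \<open>w\<close> is
    general because it changes on passing to a subword.\<close>
  have main: "act w (eval Q h P) \<otimes>\<^bsub>G\<^esub> S (terms num P w False) = S (terms num P w True)"
    if "P \<in> words A" for P w
    using that
  proof (induction P arbitrary: w)
    case (Letter a)
    have "h a \<in> carrier G" using Letter h car by auto
    then show ?case using Letter by (simp add: S_simps v_letter act_closed)
  next
    case (Mult s t)
    then have st: "eval Q h s \<in> carrier G" "eval Q h t \<in> carrier G" by (simp_all add: ev_closed)
    note IH = Mult.IH(1)[of "cons_red 0 w", symmetric] Mult.IH(2)[of "cons_red 2 w", symmetric]
    show ?case
      using Mult.prems st c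
      by (simp add: S_simps IH mul v_c act_mult act_red gens cl act_closed S_closed G.m_ac)
  next
    case (RDiv s t)
    then have st: "eval Q h s \<in> carrier G" "eval Q h t \<in> carrier G" by (simp_all add: ev_closed)
    let ?z = "rdiv Q (eval Q h s) (eval Q h t)" and ?w = "cons_red 1 w"
    have z: "?z \<in> carrier G" using st by (simp add: qg)
    have "act ?w (\<phi> ?z \<otimes>\<^bsub>G\<^esub> c \<otimes>\<^bsub>G\<^esub> \<psi> (eval Q h t)) = act ?w (eval Q h s)"
      using qg(5)[OF st] z st by (simp add: mul)
    \<comment> \<open>The prefix 1 stands for the inverse of \<phi>, so \<open>act ?w\<close>
      cancels \<phi> on the quotient and leaves \<open>act w ?z\<close>.\<close>
    then have e: "act w ?z \<otimes>\<^bsub>G\<^esub> act ?w c \<otimes>\<^bsub>G\<^esub> act (cons_red 2 ?w) (eval Q h t) = act ?w (eval Q h s)"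
      using z st c by (simp add: act_mult cl act_red gens gens' gen_closed)
    show ?case
      using key_eq[OF e RDiv.IH(1) RDiv.IH(2)] RDiv.prems z c st
      by (simp add: S_simps v_c act_closed S_closed)
  next
    case (LDiv s t)
    then have st: "eval Q h s \<in> carrier G" "eval Q h t \<in> carrier G" by (simp_all add: ev_closed)
    let ?z = "ldiv Q (eval Q h s) (eval Q h t)" and ?w = "cons_red 3 w"
    have z: "?z \<in> carrier G" using st by (simp add: qg)
    have "\<phi> (eval Q h s) \<otimes>\<^bsub>G\<^esub> c \<otimes>\<^bsub>G\<^esub> \<psi> ?z = eval Q h t"
      using qg(6)[OF st(2,1)] z st by (simp add: mul)
    moreover have "\<phi> (eval Q h s) \<otimes>\<^bsub>G\<^esub> c \<otimes>\<^bsub>G\<^esub> \<psi> ?z = \<psi> ?z \<otimes>\<^bsub>G\<^esub> c \<otimes>\<^bsub>G\<^esub> \<phi> (eval Q h s)"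
      using z st c by (simp add: cl G.m_ac)
    ultimately have "act ?w (\<psi> ?z \<otimes>\<^bsub>G\<^esub> c \<otimes>\<^bsub>G\<^esub> \<phi> (eval Q h s)) = act ?w (eval Q h t)"
      by simp
    then have e: "act w ?z \<otimes>\<^bsub>G\<^esub> act ?w c \<otimes>\<^bsub>G\<^esub> act (cons_red 0 ?w) (eval Q h s) = act ?w (eval Q h t)"
      using z st c by (simp add: act_mult cl act_red gens gens' gen_closed)
    show ?case
      using key_eq[OF e LDiv.IH(2) LDiv.IH(1)] LDiv.prems z c st
      by (simp add: S_simps v_c act_closed S_closed)
  qed
  have act_Nil: "act [] x = x" for x by (simp add: act_def)
  let ?e1 = "eval Q h P1" and ?e2 = "eval Q h P2"
    and ?n = "S (terms num P1 [] False) \<otimes>\<^bsub>G\<^esub> S (terms num P2 [] False)"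
  have "S (terms num P1 [] True + terms num P2 [] False) = ?e1 \<otimes>\<^bsub>G\<^esub> ?n"
    using main[OF P(1), of "[]", symmetric] ev_closed[OF P(1)]
    by (simp add: S_simps act_Nil S_closed G.m_assoc)
  moreover have "S (terms num P2 [] True + terms num P1 [] False) = ?e2 \<otimes>\<^bsub>G\<^esub> ?n"
    using main[OF P(2), of "[]", symmetric] ev_closed[OF P(2)]
    by (simp add: S_simps act_Nil S_closed G.m_ac)
  ultimately have "?e1 \<otimes>\<^bsub>G\<^esub> ?n = ?e2 \<otimes>\<^bsub>G\<^esub> ?n" using eq by simp
  then show ?thesis
    using ev_closed P S_closed by (subst (asm) G.right_cancel) auto
qed

text \<open>Serves both as the number of machine steps for a word and as a bound on its number of
  terms. The order of the summands for \<open>LDiv\<close> is the stack order, with \<open>t\<close>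
  on top.\<close>

primrec nodes :: "'a qword \<Rightarrow> nat" where
  "nodes (Letter a) = 1"
| "nodes (Mult s t) = Suc (nodes s + nodes t)"
| "nodes (RDiv s t) = Suc (nodes s + nodes t)"
| "nodes (LDiv s t) = Suc (nodes t + nodes s)"

lemma size_terms_le: "size (terms num P w b) \<le> nodes P"
proof (induction P arbitrary: w b)
  case (Mult s t)
  show ?case
    using Mult.IH(1)[of "cons_red 0 w" b] Mult.IH(2)[of "cons_red 2 w" b] by (auto simp: single_if_def)
next
  case (RDiv s t)
  show ?case
    using RDiv.IH(1)[of "cons_red 1 w" b] RDiv.IH(2)[of "cons_red 2 (cons_red 1 w)" "\<not> b"]
    by (auto simp: single_if_def)
next
  case (LDiv s t)
  show ?case
    using LDiv.IH(1)[of "cons_red 0 (cons_red 3 w)" "\<not> b"] LDiv.IH(2)[of "cons_red 3 w" b]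
    by (auto simp: single_if_def)
qed (simp add: single_if_def)

lemma le_triangle: "n \<le> triangle n"
  by (induction n) auto

lemma add_le_prod_encode: "a + b \<le> prod_encode (a, b)"
  using le_triangle[of "a + b"] by (simp add: prod_encode_def)

text \<open>The positive tag of a compound word enlarges its code enough to absorb the
  \<open>Suc\<close> of both subwords. The \<open>Suc\<close> itself covers a letter with code
  0.\<close>

lemma nodes_le_code: "nodes P \<le> Suc (word_code num P)"
proof (induction P)
  have *: "m + n \<le> prod_encode (k, prod_encode (a, b))"
    if "m \<le> Suc a" "n \<le> Suc b" "0 < k" for m n a b k
  proof -
    let ?x = "prod_encode (a, b)"
    have "a + b \<le> ?x" by (rule add_le_prod_encode)
    moreover have "Suc ?x \<le> triangle (Suc ?x)" by (rule le_triangle)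
    moreover have "triangle (Suc ?x) \<le> triangle (k + ?x)" by (rule triangle_mono) (use that in simp)
    moreover have "prod_encode (k, ?x) = triangle (k + ?x) + k"
      by (simp only: prod_encode_def prod.case)
    ultimately show ?thesis using that by linarith
  qed
  {
    case Mult then show ?case by (simp add: *)
  next
    case RDiv then show ?case by (simp add: *)
  next
    case LDiv then show ?case using *[OF LDiv, of 3] by simp
  }
qed simp

text \<open>The bound on \<open>B\<close> depends only on the codes, yet exceeds the number of terms
  on either side, so the power sums determine the multisets.\<close>

theorem represented_eq_iff_power_sum:
  assumes num: "inj_on num A" and P: "P1 \<in> words A" "P2 \<in> words A"
    and B: "word_code num P1 + word_code num P2 + 2 < B"
  shows "represented A P1 = represented A P2 \<longleftrightarrow>
    power_sum B (terms num P1 [] True + terms num P2 [] False) =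
    power_sum B (terms num P2 [] True + terms num P1 [] False)"
proof
  assume eq: "power_sum B (terms num P1 [] True + terms num P2 [] False) =
    power_sum B (terms num P2 [] True + terms num P1 [] False)"
  have size: "size (terms num P1 [] b) + size (terms num P2 [] b') < B" for b b'
    using size_terms_le[of num P1 "[]" b] size_terms_le[of num P2 "[]" b']
      nodes_le_code[of P1 num] nodes_le_code[of P2 num] B by linarith
  have "terms num P1 [] True + terms num P2 [] False = terms num P2 [] True + terms num P1 [] False"
    by (rule power_sum_inject[OF _ _ eq])
      (use size[of True False] size[of False True] in simp_all)
  then show "represented A P1 = represented A P2"
    using eval_eq_of_terms_eq[OF _ _ num P] free_eq_iff_identity[OF P] by blast
qed (rule power_sum_terms_eq[OF P])


section \<open>The algorithm\<close>

text \<open>These mirror \<open>list_encode\<close>, where 0 codes the empty list and every other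
  code carries a \<open>Suc\<close>.\<close>

definition push :: "nat \<Rightarrow> nat \<Rightarrow> nat" where "push x l = Suc (prod_encode (x, l))"
definition top_of :: "nat \<Rightarrow> nat" where "top_of l = fst (prod_decode (l - 1))"
definition pop :: "nat \<Rightarrow> nat" where "pop l = snd (prod_decode (l - 1))"

lemma list_code_simps [simp]:
  "push x (list_encode xs) = list_encode (x # xs)"
  "top_of (list_encode (x # xs)) = x" "pop (list_encode (x # xs)) = list_encode xs"
  by (simp_all add: push_def top_of_def pop_def)

definition cons_red_code :: "nat \<Rightarrow> nat \<Rightarrow> nat" where
  "cons_red_code k l = (if l = 0 then push k l else if top_of l = opp k then pop l else push k l)"

lemma cons_red_code [simp]: "cons_red_code k (list_encode w) = list_encode (cons_red k w)"
  by (cases w) (auto simp: cons_red_code_def cons_red_def push_def top_of_def pop_def)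

definition item :: "nat \<Rightarrow> nat \<Rightarrow> nat \<Rightarrow> nat" where
  "item p b l = prod_encode (p, prod_encode (b, l))"

text \<open>The state of the machine is a pair of a stack of pending subwords and an accumulator. An
  item consists of a subword, the sign that it contributes with (\<open>1\<close> for positive), and
  the word in $\varphi, \psi$ acting on it. Only positive terms are added up.\<close>

definition emit :: "nat \<Rightarrow> nat \<Rightarrow> nat \<Rightarrow> nat \<Rightarrow> nat" where
  "emit B b x l = b * B ^ prod_encode (x, l)"

text \<open>\<open>z\<close> is the payload below the tag, a letter number when
  \<open>tag = 0\<close>; otherwise \<open>x\<close> and \<open>y\<close> are its halves, the codes
  of the subwords. \<open>1 - b\<close> flips the sign.\<close>

definition machine_step :: "nat \<Rightarrow> nat \<Rightarrow> nat \<Rightarrow> nat \<Rightarrow> nat \<Rightarrow> nat \<Rightarrow> nat \<Rightarrow> nat \<Rightarrow> nat \<Rightarrow> nat" where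
  "machine_step B stk acc tag x y b l z =
    (if tag = 0 then prod_encode (stk, acc + emit B b (Suc z) l)
     else if tag = 1 then
       prod_encode (push (item x b (cons_red_code 0 l)) (push (item y b (cons_red_code 2 l)) stk),
         acc + emit B b 0 l)
     else if tag = 2 then
       prod_encode (push (item x b (cons_red_code 1 l))
           (push (item y (1 - b) (cons_red_code 2 (cons_red_code 1 l))) stk),
         acc + emit B (1 - b) 0 (cons_red_code 1 l))
     else
       prod_encode (push (item y b (cons_red_code 3 l))
           (push (item x (1 - b) (cons_red_code 0 (cons_red_code 3 l))) stk),
         acc + emit B (1 - b) 0 (cons_red_code 3 l)))"

definition step :: "nat \<Rightarrow> nat \<Rightarrow> nat" where
  "step B st = (if fst (prod_decode st) = 0 then st else
    let i = top_of (fst (prod_decode st)); p = fst (prod_decode i); q = snd (prod_decode p)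
    in machine_step B (pop (fst (prod_decode st))) (snd (prod_decode st))
      (fst (prod_decode p)) (fst (prod_decode q)) (snd (prod_decode q))
      (fst (prod_decode (snd (prod_decode i)))) (snd (prod_decode (snd (prod_decode i)))) q)"

definition pending :: "('a \<Rightarrow> nat) \<Rightarrow> 'a qword \<Rightarrow> bool \<Rightarrow> nat list \<Rightarrow> nat" where
  "pending num P b w = item (word_code num P) (of_bool b) (list_encode w)"

lemma step_pending:
  "step B (prod_encode (list_encode (pending num (Letter a) b w # stk), acc)) =
    prod_encode (list_encode stk, acc + power_sum B (single_if b (key (Suc (num a)) w)))"
  "step B (prod_encode (list_encode (pending num (Mult s t) b w # stk), acc)) =
    prod_encode (list_encode (pending num s b (cons_red 0 w) # pending num t b (cons_red 2 w) # stk),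
      acc + power_sum B (single_if b (key 0 w)))"
  "step B (prod_encode (list_encode (pending num (RDiv s t) b w # stk), acc)) =
    prod_encode (list_encode (pending num s b (cons_red 1 w) #
        pending num t (\<not> b) (cons_red 2 (cons_red 1 w)) # stk),
      acc + power_sum B (single_if (\<not> b) (key 0 (cons_red 1 w))))"
  "step B (prod_encode (list_encode (pending num (LDiv s t) b w # stk), acc)) =
    prod_encode (list_encode (pending num t b (cons_red 3 w) #
        pending num s (\<not> b) (cons_red 0 (cons_red 3 w)) # stk),
      acc + power_sum B (single_if (\<not> b) (key 0 (cons_red 3 w))))"
  by (simp_all add: step_def machine_step_def pending_def item_def emit_def key_def Let_def
      del: list_encode.simps(2)) (simp_all add: of_bool_def)

lemma step_finished: "step B (prod_encode (0, acc)) = prod_encode (0, acc)"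
  by (simp add: step_def)

text \<open>The two subwords of a compound word are consumed in turn, the second lying below the
  first on the stack; hence \<open>n\<close>, \<open>stk\<close> and \<open>acc\<close> are
  general.\<close>

lemma run_pending:
  "(step B ^^ (nodes P + n)) (prod_encode (list_encode (pending num P b w # stk), acc)) =
   (step B ^^ n) (prod_encode (list_encode stk, acc + power_sum B (terms num P w b)))"
proof (induction P arbitrary: n b w stk acc)
  case (Letter a)
  show ?case by (simp add: funpow_Suc_right step_pending(1) del: funpow.simps list_encode.simps)
next
  case (Mult s t)
  show ?case
    by (simp add: funpow_Suc_right step_pending(2) Mult.IH add.assoc del: funpow.simps list_encode.simps)
next
  case (RDiv s t)
  show ?case
    by (simp add: funpow_Suc_right step_pending(3) RDiv.IH add.assoc del: funpow.simps list_encode.simps)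
next
  case (LDiv s t)
  show ?case
    by (simp add: funpow_Suc_right step_pending(4) LDiv.IH add.assoc del: funpow.simps list_encode.simps)
qed

text \<open>Starting \<open>p\<close> with sign 1 and \<open>q\<close> with sign 0 collects the
  positive terms of \<open>p\<close> and the negative ones of \<open>q\<close>. For codes of words,
  \<open>p + q + 2\<close> steps suffice by \<open>nodes_le_code\<close>, and surplus steps leave
  the empty stack fixed.\<close>

definition positive_sum :: "nat \<Rightarrow> nat \<Rightarrow> nat \<Rightarrow> nat" where
  "positive_sum B p q = snd (prod_decode (rec_nat
     (prod_encode (push (item p 1 0) (push (item q 0 0) 0), 0)) (\<lambda>k. step B) (p + q + 2)))"

lemma positive_sum_code:
  "positive_sum B (word_code num P) (word_code num Q) =
    power_sum B (terms num P [] True + terms num Q [] False)"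
proof -
  have rec: "rec_nat x (\<lambda>k. step B) n = (step B ^^ n) x" for x n
    by (induction n) auto
  have fin: "(step B ^^ n) (prod_encode (0, acc)) = prod_encode (0, acc)" for n acc
    by (induction n) (auto simp: step_finished)
  have "nodes P + nodes Q \<le> word_code num P + word_code num Q + 2"
    using nodes_le_code[of P num] nodes_le_code[of Q num] by linarith
  then obtain m where m: "word_code num P + word_code num Q + 2 = nodes P + (nodes Q + m)"
    by (metis le_Suc_ex add.assoc)
  have "push (item (word_code num P) 1 0) (push (item (word_code num Q) 0 0) 0) =
      list_encode [pending num P True [], pending num Q False []]"
    by (simp add: pending_def push_def)
  then show ?thesis
    unfolding positive_sum_def rec m
    by (simp add: run_pending fin del: list_encode.simps(2))
qed

section \<open>Recursiveness of the machine\<close>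

lemma
  assumes "recursive n f"
  shows recursive_top_of: "recursive n (\<lambda>xs. top_of (f xs))"
    and recursive_pop: "recursive n (\<lambda>xs. pop (f xs))"
    and recursive_cons_red_code: "recursive n (\<lambda>xs. cons_red_code k (f xs))"
  unfolding cons_red_code_def push_def top_of_def pop_def by (intro recursive_intros assms)+

lemma recursive_push:
  assumes "recursive n f" "recursive n g"
  shows "recursive n (\<lambda>xs. push (f xs) (g xs))"
  unfolding push_def by (intro recursive_intros assms)

lemma recursive_item:
  assumes "recursive n f" "recursive n g" "recursive n h"
  shows "recursive n (\<lambda>xs. item (f xs) (g xs) (h xs))"
  unfolding item_def by (intro recursive_intros assms)

lemma recursive_step:
  assumes "recursive n f" "recursive n g"
  shows "recursive n (\<lambda>xs. step (f xs) (g xs))"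
  unfolding step_def machine_step_def emit_def Let_def
  by (intro recursive_intros recursive_push recursive_item recursive_top_of recursive_pop
      recursive_cons_red_code assms)

lemma recursive_positive_sum:
  assumes "recursive n f" "recursive n g" "recursive n h"
  shows "recursive n (\<lambda>xs. positive_sum (f xs) (g xs) (h xs))"
proof (rule recursive_comp3[OF _ assms])
  have "recursive (3 + 2) (\<lambda>ys. step (drop 2 ys ! 0) (ys ! 1))"
    by (intro recursive_step recursive_proj_drop recursive.proj) simp_all
  then show "recursive 3 (\<lambda>xs. positive_sum (xs ! 0) (xs ! 1) (xs ! 2))"
    unfolding positive_sum_def
    by (intro recursive_snd recursive_rec_nat recursive_prod_encode recursive_push recursive_item
        recursive_const recursive_add recursive.proj) simp_all
qed

theorem theorem1p1:
  fixes A :: "'a set" and num :: "'a \<Rightarrow> nat"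
  assumes "inj_on num A"
  shows "\<exists>f. recursive 2 f \<and>
    (\<forall>P1 \<in> words A. \<forall>P2 \<in> words A.
       f [word_code num P1, word_code num P2] =
         (if represented A P1 = represented A P2 then 1 else 0))"
proof -
  \<comment> \<open>The summand 3 puts the base strictly above the bound in
    \<open>represented_eq_iff_power_sum\<close>; swapping the codes yields the other side of the
    equation.\<close>
  define f where "f xs = (if positive_sum (xs ! 0 + xs ! 1 + 3) (xs ! 0) (xs ! 1) =
    positive_sum (xs ! 0 + xs ! 1 + 3) (xs ! 1) (xs ! 0) then 1 else 0 :: nat)" for xs
  have "recursive 2 f"
    unfolding f_def by (intro recursive_intros recursive_positive_sum recursive.proj) simp_all
  moreover have "f [word_code num P1, word_code num P2] =
      (if represented A P1 = represented A P2 then 1 else 0)"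
    if "P1 \<in> words A" "P2 \<in> words A" for P1 P2
    using represented_eq_iff_power_sum[OF assms that, of "word_code num P1 + word_code num P2 + 3"]
    by (simp add: f_def positive_sum_code del: power_sum_simps)
  ultimately show ?thesis by blast
qed

end
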